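(* The simple Chevalley group $G_2(5)$ is non-$FSZ_5$, and its Sylow $5$-subgroup is non-$FSZ_5$.
   Context: $\mathbb{N}$ denotes the positive integers. For a group $G$, $u,g\in G$ and $m\in\mathbb{N}$, define $G_m(u,g)=\{a\in G : a^m=(au^{-1})^m=g\}$. The group $G$ is $FSZ_m$ if and only if for all $g\in G$, all $u\in C_G(g)$, and all $n\in\mathbb{N}$ coprime to the order of $g$, one has $|G_m(u,g)|=|G_m(u,g^n)|$. "Non-$FSZ_m$" means not $FSZ_m$. $G_2(5)$ denotes the finite simple Chevalley group of type $G_2$ over the field with $5$ elements. *)

theory Defs
  imports
    "HOL-Analysis.Analysis"
    "HOL-Algebra.Generated_Groups"
    "HOL-Algebra.Multiplicative_Group"
    "Berlekamp_Zassenhaus.Finite_Field"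
begin

section \<open>The $FSZ_m$ property\<close>

definition FSZ_set :: "('a, 'b) monoid_scheme \<Rightarrow> nat \<Rightarrow> 'a \<Rightarrow> 'a \<Rightarrow> 'a set" where
  "FSZ_set G m u g =
     {a \<in> carrier G. a [^]\<^bsub>G\<^esub> m = g \<and> (a \<otimes>\<^bsub>G\<^esub> inv\<^bsub>G\<^esub> u) [^]\<^bsub>G\<^esub> m = g}"

definition centralizer :: "('a, 'b) monoid_scheme \<Rightarrow> 'a \<Rightarrow> 'a set" where
  "centralizer G g = {u \<in> carrier G. u \<otimes>\<^bsub>G\<^esub> g = g \<otimes>\<^bsub>G\<^esub> u}"

text \<open>Meant for finite groups: \<open>card\<close> is \<open>0\<close> on infinite sets and \<open>group.ord\<close> is \<open>0\<close> on
  elements of infinite order.\<close>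

definition FSZ :: "nat \<Rightarrow> ('a, 'b) monoid_scheme \<Rightarrow> bool" where
  "FSZ m G \<longleftrightarrow>
     (\<forall>g \<in> carrier G. \<forall>u \<in> centralizer G g. \<forall>n::nat. n > 0 \<and> coprime n (group.ord G g) \<longrightarrow>
        card (FSZ_set G m u g) = card (FSZ_set G m u (g [^]\<^bsub>G\<^esub> n)))"

definition sylow_subgroup :: "nat \<Rightarrow> ('a, 'b) monoid_scheme \<Rightarrow> 'a set \<Rightarrow> bool" where
  "sylow_subgroup p G P \<longleftrightarrow> subgroup P G \<and> card P = p ^ multiplicity p (order G)"


section \<open>The root system of type $G_2$\<close>

text \<open>The simple roots are \<open>\<alpha>\<close> (short) and \<open>\<beta>\<close> (long); \<open>Rij\<close> is the positive root \<open>i \<alpha> + j \<beta>\<close>.\<close>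

datatype g2_pos = R10 | R01 | R11 | R21 | R31 | R32

datatype g2_root = Pos g2_pos | Neg g2_pos

fun pos_vec :: "g2_pos \<Rightarrow> int \<times> int" where
  "pos_vec R10 = (1, 0)"
| "pos_vec R01 = (0, 1)"
| "pos_vec R11 = (1, 1)"
| "pos_vec R21 = (2, 1)"
| "pos_vec R31 = (3, 1)"
| "pos_vec R32 = (3, 2)"

fun root_vec :: "g2_root \<Rightarrow> int \<times> int" where
  "root_vec (Pos p) = pos_vec p"
| "root_vec (Neg p) = - pos_vec p"

fun root_ip :: "int \<times> int \<Rightarrow> int \<times> int \<Rightarrow> int" where
  "root_ip (a, b) (c, d) = 2 * (a * c) + 6 * (b * d) - 3 * (a * d + b * c)"

text \<open>The Cartan integer \<open>\<langle>s, r\<^sup>\<or>\<rangle> = 2 (r, s) / (r, r)\<close>.\<close>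

definition cartan_int :: "g2_root \<Rightarrow> g2_root \<Rightarrow> int" where
  "cartan_int r s = 2 * root_ip (root_vec r) (root_vec s) div root_ip (root_vec r) (root_vec r)"


section \<open>A Chevalley basis of the complex simple Lie algebra of type $G_2$\<close>

text \<open>The structure constants \<open>N r s\<close>, defined by \<open>[e r, e s] = N r s e (r + s)\<close>, of one fixed
  Chevalley basis. On pairs of positive roots the signs are those of the choice \<open>N > 0\<close> on the
  extraspecial pairs; the value \<open>- 3\<close> is then forced by the Jacobi identity.\<close>

fun N_pos :: "g2_pos \<Rightarrow> g2_pos \<Rightarrow> int" where
  "N_pos R10 R01 = 1"
| "N_pos R01 R10 = - 1"
| "N_pos R10 R11 = 2"
| "N_pos R11 R10 = - 2"
| "N_pos R10 R21 = 3"
| "N_pos R21 R10 = - 3"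
| "N_pos R01 R31 = 1"
| "N_pos R31 R01 = - 1"
| "N_pos R11 R21 = - 3"
| "N_pos R21 R11 = 3"
| "N_pos _ _ = 0"

definition pos_len :: "g2_pos \<Rightarrow> int" where
  "pos_len p = root_ip (pos_vec p) (pos_vec p)"

text \<open>For the remaining pairs one uses \<open>N s r = - N r s = N (-r) (-s)\<close> and the cyclic symmetry
  \<open>N r s / (t, t) = N s t / (r, r) = N t r / (s, s)\<close> whenever \<open>r + s + t = 0\<close>.
  \<open>N_mixed p q\<close> is the value \<open>N p (-q)\<close>; at most one \<open>t\<close> contributes to the sum, and the divisions
  are exact.\<close>

definition N_mixed :: "g2_pos \<Rightarrow> g2_pos \<Rightarrow> int" where
  "N_mixed p q =
     (\<Sum>t\<in>UNIV.
        if pos_vec p = pos_vec q + pos_vec t then - ((pos_len t * N_pos q t) div pos_len p)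
        else if pos_vec q = pos_vec p + pos_vec t then (pos_len t * N_pos t p) div pos_len q
        else 0)"

fun N_const :: "g2_root \<Rightarrow> g2_root \<Rightarrow> int" where
  "N_const (Pos p) (Pos q) = N_pos p q"
| "N_const (Neg p) (Neg q) = - N_pos p q"
| "N_const (Pos p) (Neg q) = N_mixed p q"
| "N_const (Neg p) (Pos q) = - N_mixed q p"

text \<open>The basis consists of the simple coroots \<open>h \<alpha> = Cartan_a\<close> and \<open>h \<beta> = Cartan_b\<close> and the root
  vectors \<open>e r = Root r\<close>.\<close>

datatype g2_basis = Cartan_a | Cartan_b | Root g2_root

text \<open>\<open>bracket x y z\<close> is the coefficient of \<open>z\<close> in \<open>[x, y]\<close>. In particular \<open>[e r, e (-r)]\<close> is the
  coroot of \<open>r = a \<alpha> + b \<beta>\<close>, which equals \<open>(a (\<alpha>, \<alpha>) h \<alpha> + b (\<beta>, \<beta>) h \<beta>) / (r, r)\<close>.\<close>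

fun bracket :: "g2_basis \<Rightarrow> g2_basis \<Rightarrow> g2_basis \<Rightarrow> int" where
  "bracket Cartan_a (Root s) z = (if z = Root s then cartan_int (Pos R10) s else 0)"
| "bracket Cartan_b (Root s) z = (if z = Root s then cartan_int (Pos R01) s else 0)"
| "bracket (Root r) Cartan_a z = (if z = Root r then - cartan_int (Pos R10) r else 0)"
| "bracket (Root r) Cartan_b z = (if z = Root r then - cartan_int (Pos R01) r else 0)"
| "bracket (Root r) (Root s) (Root t) =
     (if root_vec r + root_vec s = root_vec t then N_const r s else 0)"
| "bracket (Root r) (Root s) Cartan_a =
     (if root_vec r + root_vec s = 0
      then fst (root_vec r) * 2 div root_ip (root_vec r) (root_vec r) else 0)"
| "bracket (Root r) (Root s) Cartan_b =
     (if root_vec r + root_vec s = 0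
      then snd (root_vec r) * 6 div root_ip (root_vec r) (root_vec r) else 0)"
| "bracket _ _ _ = 0"

lemma UNIV_g2_pos: "UNIV = {R10, R01, R11, R21, R31, R32}"
  using g2_pos.exhaust by blast

lemma UNIV_g2_root: "UNIV = range Pos \<union> range Neg"
proof -
  have "r \<in> range Pos \<union> range Neg" for r by (cases r) simp_all
  then show ?thesis by blast
qed

lemma UNIV_g2_basis: "UNIV = {Cartan_a, Cartan_b} \<union> range Root"
proof -
  have "x \<in> {Cartan_a, Cartan_b} \<union> range Root" for x by (cases x) simp_all
  then show ?thesis by blast
qed

instance g2_pos :: finite
  by standard (simp add: UNIV_g2_pos)

instance g2_root :: finite
  by standard (simp add: UNIV_g2_root)

instance g2_basis :: finite
  by standard (simp add: UNIV_g2_basis)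

text \<open>The defining property of a Chevalley basis: \<open>N r s = \<plusminus> (p + 1)\<close>, where \<open>p\<close> is the largest integer
  such that \<open>s - p r\<close> is a root. Root strings are unbroken, so \<open>p\<close> counts the roots among the
  \<open>s - k r\<close> with \<open>k \<ge> 1\<close>, and \<open>p \<le> 3\<close>.\<close>

lemma range_root_vec:
  "range root_vec =
     {(1, 0), (0, 1), (1, 1), (2, 1), (3, 1), (3, 2),
      (-1, 0), (0, -1), (-1, -1), (-2, -1), (-3, -1), (-3, -2)}"
  by (simp add: UNIV_g2_root UNIV_g2_pos image_Un insert_commute)

lemma in_range_root_vec:
  "(a, b) \<in> range root_vec \<longleftrightarrow>
     (a = 1 \<and> b = 0) \<or> (a = 0 \<and> b = 1) \<or> (a = 1 \<and> b = 1) \<or>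
     (a = 2 \<and> b = 1) \<or> (a = 3 \<and> b = 1) \<or> (a = 3 \<and> b = 2) \<or>
     (a = - 1 \<and> b = 0) \<or> (a = 0 \<and> b = - 1) \<or> (a = - 1 \<and> b = - 1) \<or>
     (a = - 2 \<and> b = - 1) \<or> (a = - 3 \<and> b = - 1) \<or> (a = - 3 \<and> b = - 2)"
  unfolding range_root_vec by (simp only: insert_iff prod.inject empty_iff simp_thms)

lemma abs_N_const:
  assumes "root_vec r + root_vec s \<in> range root_vec"
  shows "\<bar>N_const r s\<bar> =
           1 + of_bool (root_vec s - root_vec r \<in> range root_vec)
             + of_bool (root_vec s - root_vec r - root_vec r \<in> range root_vec)
             + of_bool (root_vec s - root_vec r - root_vec r - root_vec r \<in> range root_vec)"
proof (cases r; cases s)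
  fix p q assume "r = Pos p" "s = Pos q"
  then show ?thesis using assms
    by (cases p; cases q) (simp_all add: in_range_root_vec)
next
  fix p q assume "r = Pos p" "s = Neg q"
  then show ?thesis using assms
    by (cases p; cases q) (simp_all add: in_range_root_vec N_mixed_def UNIV_g2_pos pos_len_def)
next
  fix p q assume "r = Neg p" "s = Pos q"
  then show ?thesis using assms
    by (cases p; cases q) (simp_all add: in_range_root_vec N_mixed_def UNIV_g2_pos pos_len_def)
next
  fix p q assume "r = Neg p" "s = Neg q"
  then show ?thesis using assms
    by (cases p; cases q) (simp_all add: in_range_root_vec)
qed

lemma N_const_antisym: "N_const s r = - N_const r s"
proof -
  have *: "N_pos q p = - N_pos p q" for p q
    by (cases p; cases q) (simp_all only: N_pos.simps minus_minus minus_zero)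
  show ?thesis
    by (cases r; cases s) (metis * N_const.simps minus_minus)+
qed


section \<open>The Chevalley group $G_2(K)$\<close>

definition GL :: "('k::field ^ 'n ^ 'n) monoid" where
  "GL = \<lparr>carrier = {A. invertible A}, mult = (**), one = mat 1\<rparr>"

text \<open>The matrix of \<open>(ad (e r))\<^sup>n\<close>; the coordinates of the image of \<open>y\<close> form column \<open>y\<close>.\<close>

definition ad_root_pow :: "g2_root \<Rightarrow> nat \<Rightarrow> int ^ g2_basis ^ g2_basis" where
  "ad_root_pow r n = (((**) (\<chi> z y. bracket (Root r) y z)) ^^ n) (mat 1)"

text \<open>The matrix of \<open>exp (t ad (e r)) = (\<Sum>n. t\<^sup>n (ad (e r))\<^sup>n / n!)\<close>, where the division by \<open>n!\<close> is
  carried out (without remainder) over the integers, before passing to the field. The sum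
  stops at \<open>n = 3\<close> because \<open>(ad (e r))\<^sup>4 = 0\<close>.\<close>

definition root_element :: "g2_root \<Rightarrow> 'k::field \<Rightarrow> 'k ^ g2_basis ^ g2_basis" where
  "root_element r t =
     (\<chi> z y. \<Sum>n\<le>3. t ^ n * of_int ((ad_root_pow r n $ z $ y) div fact n))"

text \<open>The (adjoint) Chevalley group of type \<open>G\<^sub>2\<close> over \<open>K\<close>: the group of automorphisms of the Lie
  algebra over \<open>K\<close> generated by all root elements.\<close>

definition chevalley_G2 :: "('k::field ^ g2_basis ^ g2_basis) monoid" where
  "chevalley_G2 = GL\<lparr>carrier := generate GL (range (\<lambda>(r, t). root_element r t))\<rparr>"


section \<open>The field with five elements\<close>

text \<open>An index type with five elements, as \<open>mod_ring\<close> takes its modulus from a type.\<close>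

typedef five = "{0..<5::nat}"
  by (rule exI[of _ 0]) simp

lemma CARD_five: "CARD(five) = 5"
  using type_definition.card[OF type_definition_five] by simp

instance five :: prime_card
  by standard (simp add: CARD_five)

type_synonym gf5 = "five mod_ring"

abbreviation G2_5 :: "(gf5 ^ g2_basis ^ g2_basis) monoid" where
  "G2_5 \<equiv> chevalley_G2"

end

theory Submission
  imports Defs "HOL-Algebra.Left_Coset" "HOL-Algebra.Group_Action"
begin

text \<open>Let \<open>e\<close> be a root vector for the highest root, \<open>g = exp (\<tau> ad e)\<close>. An element \<open>c\<close> of
  the group with \<open>c\<^sup>5 = g\<close> commutes with \<open>g\<close>, hence fixes \<open>e\<close>, hence acts on the five-dimensional
  Heisenberg algebra \<open>Q = ker (ad e) \<inter> im (ad e)\<close>. Modulo \<open>e\<close> the latter is the space of binary cubic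
  forms, and \<open>c\<close> permutes the cubes of linear forms; as \<open>c\<close> preserves the symplectic form, for which
  the product of two cubes is the cube of the determinant, \<open>c\<close> acts through a matrix \<open>m\<close> in \<open>SL(2,5)\<close>
  with \<open>m\<^sup>5 = 1\<close>, so \<open>m\<close> has trace 2. If \<open>c u\<^sup>-\<^sup>1\<close> is another fifth root of \<open>g\<close>, where \<open>u\<close> acts through the
  transvection \<open>(1, 1; 0, 1)\<close>, then comparing the traces shows that \<open>m = (1, s; 0, 1)\<close>. If moreover
  \<open>c\<close> maps the root vector \<open>e'\<close> for \<open>3 \<alpha> + \<beta>\<close> to \<open>e' + t e\<close>, then \<open>c\<^sup>5 = exp (3 s\<^sup>3 t\<^sup>2 ad e)\<close>.
  For a suitable \<open>u\<close> the parameters of \<open>c u\<^sup>-\<^sup>1\<close> are \<open>(s - 1, t - 1)\<close>, and the system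
  \<open>3 s\<^sup>3 t\<^sup>2 = 3 (s - 1)\<^sup>3 (t - 1)\<^sup>2 = \<tau>\<close> is solvable for \<open>\<tau> = 4\<close> but not for \<open>\<tau> = 2\<close>. So one of the
  two cardinalities to be compared for \<open>g\<close> and \<open>g\<^sup>2\<close> is zero, the other is not; as the elements
  involved generate a 5-group, this is inherited by a Sylow 5-subgroup that contains them.\<close>


section \<open>The Lie bracket and the root elements in coordinates\<close>

lemma sum_g2_basis:
  "(\<Sum>z\<in>UNIV. f z) = f Cartan_a + f Cartan_b + f (Root (Pos R10)) + f (Root (Pos R01))
     + f (Root (Pos R11)) + f (Root (Pos R21)) + f (Root (Pos R31)) + f (Root (Pos R32))
     + f (Root (Neg R10)) + f (Root (Neg R01)) + f (Root (Neg R11)) + f (Root (Neg R21))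
     + f (Root (Neg R31)) + f (Root (Neg R32))"
proof -
  have *: "(UNIV :: g2_basis set) = {Cartan_a, Cartan_b,
      Root (Pos R10), Root (Pos R01), Root (Pos R11), Root (Pos R21), Root (Pos R31), Root (Pos R32),
      Root (Neg R10), Root (Neg R01), Root (Neg R11), Root (Neg R21), Root (Neg R31), Root (Neg R32)}"
    by (auto simp: UNIV_g2_basis UNIV_g2_root UNIV_g2_pos)
  show ?thesis unfolding * by (simp add: add_ac)
qed

lemma all_g2_basis:
  "(\<forall>z. P z) \<longleftrightarrow> P Cartan_a \<and> P Cartan_b \<and> P (Root (Pos R10)) \<and> P (Root (Pos R01)) \<and>
     P (Root (Pos R11)) \<and> P (Root (Pos R21)) \<and> P (Root (Pos R31)) \<and> P (Root (Pos R32)) \<and>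
     P (Root (Neg R10)) \<and> P (Root (Neg R01)) \<and> P (Root (Neg R11)) \<and> P (Root (Neg R21)) \<and>
     P (Root (Neg R31)) \<and> P (Root (Neg R32))"
proof -
  have *: "(\<forall>z. P z) \<longleftrightarrow> (\<forall>z\<in>UNIV. P z)" by simp
  show ?thesis unfolding * UNIV_g2_basis UNIV_g2_root UNIV_g2_pos by auto
qed

text \<open>Base change to \<open>'k\<close> of the integral form spanned by the Chevalley
  basis.\<close>

definition lie :: "'k::comm_ring_1 ^ g2_basis \<Rightarrow> 'k ^ g2_basis \<Rightarrow> 'k ^ g2_basis" where
  "lie x y = (\<chi> z. \<Sum>i\<in>UNIV. \<Sum>j\<in>UNIV. x $ i * y $ j * of_int (bracket i j z))"

lemma cartan_int_Pos [simp]: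
  "cartan_int (Pos R10) (Pos R10) = 2"
  "cartan_int (Pos R10) (Pos R01) = - 3"
  "cartan_int (Pos R10) (Pos R11) = - 1"
  "cartan_int (Pos R10) (Pos R21) = 1"
  "cartan_int (Pos R10) (Pos R31) = 3"
  "cartan_int (Pos R10) (Pos R32) = 0"
  "cartan_int (Pos R10) (Neg R10) = - 2"
  "cartan_int (Pos R10) (Neg R01) = 3"
  "cartan_int (Pos R10) (Neg R11) = 1"
  "cartan_int (Pos R10) (Neg R21) = - 1"
  "cartan_int (Pos R10) (Neg R31) = - 3"
  "cartan_int (Pos R10) (Neg R32) = 0"
  "cartan_int (Pos R01) (Pos R10) = - 1"
  "cartan_int (Pos R01) (Pos R01) = 2"
  "cartan_int (Pos R01) (Pos R11) = 1"
  "cartan_int (Pos R01) (Pos R21) = 0"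
  "cartan_int (Pos R01) (Pos R31) = - 1"
  "cartan_int (Pos R01) (Pos R32) = 1"
  "cartan_int (Pos R01) (Neg R10) = 1"
  "cartan_int (Pos R01) (Neg R01) = - 2"
  "cartan_int (Pos R01) (Neg R11) = - 1"
  "cartan_int (Pos R01) (Neg R21) = 0"
  "cartan_int (Pos R01) (Neg R31) = 1"
  "cartan_int (Pos R01) (Neg R32) = - 1"
  by (simp_all add: cartan_int_def)

lemma N_mixed_eq [simp]:
  "N_mixed R10 R10 = 0"
  "N_mixed R10 R01 = 0"
  "N_mixed R10 R11 = - 3"
  "N_mixed R10 R21 = - 2"
  "N_mixed R10 R31 = - 1"
  "N_mixed R10 R32 = 0"
  "N_mixed R01 R10 = 0"
  "N_mixed R01 R01 = 0"
  "N_mixed R01 R11 = 1"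
  "N_mixed R01 R21 = 0"
  "N_mixed R01 R31 = 0"
  "N_mixed R01 R32 = - 1"
  "N_mixed R11 R10 = - 3"
  "N_mixed R11 R01 = 1"
  "N_mixed R11 R11 = 0"
  "N_mixed R11 R21 = 2"
  "N_mixed R11 R31 = 0"
  "N_mixed R11 R32 = 1"
  "N_mixed R21 R10 = - 2"
  "N_mixed R21 R01 = 0"
  "N_mixed R21 R11 = 2"
  "N_mixed R21 R21 = 0"
  "N_mixed R21 R31 = 1"
  "N_mixed R21 R32 = - 1"
  "N_mixed R31 R10 = - 1"
  "N_mixed R31 R01 = 0"
  "N_mixed R31 R11 = 0"
  "N_mixed R31 R21 = 1"
  "N_mixed R31 R31 = 0"
  "N_mixed R31 R32 = 1"
  "N_mixed R32 R10 = 0"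
  "N_mixed R32 R01 = - 1"
  "N_mixed R32 R11 = 1"
  "N_mixed R32 R21 = - 1"
  "N_mixed R32 R31 = 1"
  "N_mixed R32 R32 = 0"
  by (simp_all add: N_mixed_def UNIV_g2_pos pos_len_def zero_prod_def)

text \<open>With the bracket expanded in all fourteen coordinates, identities between brackets and
  root elements become polynomial identities, checked coordinate by coordinate.\<close>

lemma lie_nth [simp]:
  fixes x y :: "'k::comm_ring_1 ^ g2_basis"
  shows
  "lie x y $ Cartan_a = x $ Root (Pos R10) * y $ Root (Neg R10)
      + x $ Root (Pos R11) * y $ Root (Neg R11)
      + 2 * (x $ Root (Pos R21) * y $ Root (Neg R21))
      + x $ Root (Pos R31) * y $ Root (Neg R31) + x $ Root (Pos R32) * y $ Root (Neg R32)
      - x $ Root (Neg R10) * y $ Root (Pos R10) - x $ Root (Neg R11) * y $ Root (Pos R11)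
      - 2 * (x $ Root (Neg R21) * y $ Root (Pos R21))
      - x $ Root (Neg R31) * y $ Root (Pos R31) - x $ Root (Neg R32) * y $ Root (Pos R32)"
  "lie x y $ Cartan_b = x $ Root (Pos R01) * y $ Root (Neg R01)
      + 3 * (x $ Root (Pos R11) * y $ Root (Neg R11))
      + 3 * (x $ Root (Pos R21) * y $ Root (Neg R21))
      + x $ Root (Pos R31) * y $ Root (Neg R31)
      + 2 * (x $ Root (Pos R32) * y $ Root (Neg R32))
      - x $ Root (Neg R01) * y $ Root (Pos R01)
      - 3 * (x $ Root (Neg R11) * y $ Root (Pos R11))
      - 3 * (x $ Root (Neg R21) * y $ Root (Pos R21))
      - x $ Root (Neg R31) * y $ Root (Pos R31) - 2 * (x $ Root (Neg R32) * y $ Root (Pos R32))"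
  "lie x y $ Root (Pos R10) = 2 * (x $ Cartan_a * y $ Root (Pos R10))
      - x $ Cartan_b * y $ Root (Pos R10) - 2 * (x $ Root (Pos R10) * y $ Cartan_a)
      + x $ Root (Pos R10) * y $ Cartan_b + x $ Root (Pos R11) * y $ Root (Neg R01)
      + 2 * (x $ Root (Pos R21) * y $ Root (Neg R11))
      + x $ Root (Pos R31) * y $ Root (Neg R21) - x $ Root (Neg R01) * y $ Root (Pos R11)
      - 2 * (x $ Root (Neg R11) * y $ Root (Pos R21)) - x $ Root (Neg R21) * y $ Root (Pos R31)"
  "lie x y $ Root (Pos R01) = - 3 * (x $ Cartan_a * y $ Root (Pos R01))
      + 2 * (x $ Cartan_b * y $ Root (Pos R01)) + 3 * (x $ Root (Pos R01) * y $ Cartan_a)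
      - 2 * (x $ Root (Pos R01) * y $ Cartan_b)
      - 3 * (x $ Root (Pos R11) * y $ Root (Neg R10))
      + x $ Root (Pos R32) * y $ Root (Neg R31)
      + 3 * (x $ Root (Neg R10) * y $ Root (Pos R11)) - x $ Root (Neg R31) * y $ Root (Pos R32)"
  "lie x y $ Root (Pos R11) = - x $ Cartan_a * y $ Root (Pos R11)
      + x $ Cartan_b * y $ Root (Pos R11) + x $ Root (Pos R10) * y $ Root (Pos R01)
      - x $ Root (Pos R01) * y $ Root (Pos R10) + x $ Root (Pos R11) * y $ Cartan_a
      - x $ Root (Pos R11) * y $ Cartan_b - 2 * (x $ Root (Pos R21) * y $ Root (Neg R10))
      - x $ Root (Pos R32) * y $ Root (Neg R21)
      + 2 * (x $ Root (Neg R10) * y $ Root (Pos R21)) + x $ Root (Neg R21) * y $ Root (Pos R32)"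
  "lie x y $ Root (Pos R21) = x $ Cartan_a * y $ Root (Pos R21)
      + 2 * (x $ Root (Pos R10) * y $ Root (Pos R11))
      - 2 * (x $ Root (Pos R11) * y $ Root (Pos R10)) - x $ Root (Pos R21) * y $ Cartan_a
      - x $ Root (Pos R31) * y $ Root (Neg R10) + x $ Root (Pos R32) * y $ Root (Neg R11)
      + x $ Root (Neg R10) * y $ Root (Pos R31) - x $ Root (Neg R11) * y $ Root (Pos R32)"
  "lie x y $ Root (Pos R31) = 3 * (x $ Cartan_a * y $ Root (Pos R31))
      - x $ Cartan_b * y $ Root (Pos R31) + 3 * (x $ Root (Pos R10) * y $ Root (Pos R21))
      - 3 * (x $ Root (Pos R21) * y $ Root (Pos R10))
      - 3 * (x $ Root (Pos R31) * y $ Cartan_a) + x $ Root (Pos R31) * y $ Cartan_b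
      - x $ Root (Pos R32) * y $ Root (Neg R01) + x $ Root (Neg R01) * y $ Root (Pos R32)"
  "lie x y $ Root (Pos R32) = x $ Cartan_b * y $ Root (Pos R32)
      + x $ Root (Pos R01) * y $ Root (Pos R31)
      - 3 * (x $ Root (Pos R11) * y $ Root (Pos R21))
      + 3 * (x $ Root (Pos R21) * y $ Root (Pos R11))
      - x $ Root (Pos R31) * y $ Root (Pos R01) - x $ Root (Pos R32) * y $ Cartan_b"
  "lie x y $ Root (Neg R10) = - 2 * (x $ Cartan_a * y $ Root (Neg R10))
      + x $ Cartan_b * y $ Root (Neg R10) + x $ Root (Pos R01) * y $ Root (Neg R11)
      + 2 * (x $ Root (Pos R11) * y $ Root (Neg R21))
      + x $ Root (Pos R21) * y $ Root (Neg R31) + 2 * (x $ Root (Neg R10) * y $ Cartan_a)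
      - x $ Root (Neg R10) * y $ Cartan_b - x $ Root (Neg R11) * y $ Root (Pos R01)
      - 2 * (x $ Root (Neg R21) * y $ Root (Pos R11)) - x $ Root (Neg R31) * y $ Root (Pos R21)"
  "lie x y $ Root (Neg R01) = 3 * (x $ Cartan_a * y $ Root (Neg R01))
      - 2 * (x $ Cartan_b * y $ Root (Neg R01))
      - 3 * (x $ Root (Pos R10) * y $ Root (Neg R11))
      + x $ Root (Pos R31) * y $ Root (Neg R32) - 3 * (x $ Root (Neg R01) * y $ Cartan_a)
      + 2 * (x $ Root (Neg R01) * y $ Cartan_b)
      + 3 * (x $ Root (Neg R11) * y $ Root (Pos R10)) - x $ Root (Neg R32) * y $ Root (Pos R31)"
  "lie x y $ Root (Neg R11) = x $ Cartan_a * y $ Root (Neg R11)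
      - x $ Cartan_b * y $ Root (Neg R11) - 2 * (x $ Root (Pos R10) * y $ Root (Neg R21))
      - x $ Root (Pos R21) * y $ Root (Neg R32) - x $ Root (Neg R10) * y $ Root (Neg R01)
      + x $ Root (Neg R01) * y $ Root (Neg R10) - x $ Root (Neg R11) * y $ Cartan_a
      + x $ Root (Neg R11) * y $ Cartan_b + 2 * (x $ Root (Neg R21) * y $ Root (Pos R10))
      + x $ Root (Neg R32) * y $ Root (Pos R21)"
  "lie x y $ Root (Neg R21) = - x $ Cartan_a * y $ Root (Neg R21)
      - x $ Root (Pos R10) * y $ Root (Neg R31) + x $ Root (Pos R11) * y $ Root (Neg R32)
      - 2 * (x $ Root (Neg R10) * y $ Root (Neg R11))
      + 2 * (x $ Root (Neg R11) * y $ Root (Neg R10)) + x $ Root (Neg R21) * y $ Cartan_a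
      + x $ Root (Neg R31) * y $ Root (Pos R10) - x $ Root (Neg R32) * y $ Root (Pos R11)"
  "lie x y $ Root (Neg R31) = - 3 * (x $ Cartan_a * y $ Root (Neg R31))
      + x $ Cartan_b * y $ Root (Neg R31) - x $ Root (Pos R01) * y $ Root (Neg R32)
      - 3 * (x $ Root (Neg R10) * y $ Root (Neg R21))
      + 3 * (x $ Root (Neg R21) * y $ Root (Neg R10))
      + 3 * (x $ Root (Neg R31) * y $ Cartan_a) - x $ Root (Neg R31) * y $ Cartan_b
      + x $ Root (Neg R32) * y $ Root (Pos R01)"
  "lie x y $ Root (Neg R32) = - x $ Cartan_b * y $ Root (Neg R32)
      - x $ Root (Neg R01) * y $ Root (Neg R31)
      + 3 * (x $ Root (Neg R11) * y $ Root (Neg R21))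
      - 3 * (x $ Root (Neg R21) * y $ Root (Neg R11))
      + x $ Root (Neg R31) * y $ Root (Neg R01) + x $ Root (Neg R32) * y $ Cartan_b"
  by (simp_all add: lie_def sum_g2_basis zero_prod_def)

lemma ad_root_pow_0 [simp]: "ad_root_pow r 0 $ z $ y = (if z = y then 1 else 0)"
  by (simp add: ad_root_pow_def mat_def)

lemma ad_root_pow_Suc:
  "ad_root_pow r (Suc n) $ z $ y = (\<Sum>w\<in>UNIV. bracket (Root r) w z * ad_root_pow r n $ w $ y)"
  by (simp add: ad_root_pow_def matrix_matrix_mult_def)

text \<open>Each equation is one row of the matrix of \<open>ad (e r)\<close>; three rewriting steps
  from \<open>ad_root_pow_0\<close> compute every power that occurs in an exponential.\<close>

lemma ad_root_pow_Suc_nth [simp]: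
  "ad_root_pow (Pos R10) (Suc n) $ Cartan_a $ y = ad_root_pow (Pos R10) n $ Root (Neg R10) $ y"
  "ad_root_pow (Pos R10) (Suc n) $ Cartan_b $ y = 0"
  "ad_root_pow (Pos R10) (Suc n) $ Root (Pos R10) $ y =
      - 2 * ad_root_pow (Pos R10) n $ Cartan_a $ y + ad_root_pow (Pos R10) n $ Cartan_b $ y"
  "ad_root_pow (Pos R10) (Suc n) $ Root (Pos R01) $ y = 0"
  "ad_root_pow (Pos R10) (Suc n) $ Root (Pos R11) $ y
      = ad_root_pow (Pos R10) n $ Root (Pos R01) $ y"
  "ad_root_pow (Pos R10) (Suc n) $ Root (Pos R21) $ y
      = 2 * ad_root_pow (Pos R10) n $ Root (Pos R11) $ y"
  "ad_root_pow (Pos R10) (Suc n) $ Root (Pos R31) $ y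
      = 3 * ad_root_pow (Pos R10) n $ Root (Pos R21) $ y"
  "ad_root_pow (Pos R10) (Suc n) $ Root (Pos R32) $ y = 0"
  "ad_root_pow (Pos R10) (Suc n) $ Root (Neg R10) $ y = 0"
  "ad_root_pow (Pos R10) (Suc n) $ Root (Neg R01) $ y =
      - 3 * ad_root_pow (Pos R10) n $ Root (Neg R11) $ y"
  "ad_root_pow (Pos R10) (Suc n) $ Root (Neg R11) $ y =
      - 2 * ad_root_pow (Pos R10) n $ Root (Neg R21) $ y"
  "ad_root_pow (Pos R10) (Suc n) $ Root (Neg R21) $ y =
      - ad_root_pow (Pos R10) n $ Root (Neg R31) $ y"
  "ad_root_pow (Pos R10) (Suc n) $ Root (Neg R31) $ y = 0"
  "ad_root_pow (Pos R10) (Suc n) $ Root (Neg R32) $ y = 0"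
  "ad_root_pow (Pos R01) (Suc n) $ Cartan_a $ y = 0"
  "ad_root_pow (Pos R01) (Suc n) $ Cartan_b $ y = ad_root_pow (Pos R01) n $ Root (Neg R01) $ y"
  "ad_root_pow (Pos R01) (Suc n) $ Root (Pos R10) $ y = 0"
  "ad_root_pow (Pos R01) (Suc n) $ Root (Pos R01) $ y
      = 3 * ad_root_pow (Pos R01) n $ Cartan_a $ y - 2 * ad_root_pow (Pos R01) n $ Cartan_b $ y"
  "ad_root_pow (Pos R01) (Suc n) $ Root (Pos R11) $ y =
      - ad_root_pow (Pos R01) n $ Root (Pos R10) $ y"
  "ad_root_pow (Pos R01) (Suc n) $ Root (Pos R21) $ y = 0"
  "ad_root_pow (Pos R01) (Suc n) $ Root (Pos R31) $ y = 0"
  "ad_root_pow (Pos R01) (Suc n) $ Root (Pos R32) $ y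
      = ad_root_pow (Pos R01) n $ Root (Pos R31) $ y"
  "ad_root_pow (Pos R01) (Suc n) $ Root (Neg R10) $ y
      = ad_root_pow (Pos R01) n $ Root (Neg R11) $ y"
  "ad_root_pow (Pos R01) (Suc n) $ Root (Neg R01) $ y = 0"
  "ad_root_pow (Pos R01) (Suc n) $ Root (Neg R11) $ y = 0"
  "ad_root_pow (Pos R01) (Suc n) $ Root (Neg R21) $ y = 0"
  "ad_root_pow (Pos R01) (Suc n) $ Root (Neg R31) $ y =
      - ad_root_pow (Pos R01) n $ Root (Neg R32) $ y"
  "ad_root_pow (Pos R01) (Suc n) $ Root (Neg R32) $ y = 0"
  "ad_root_pow (Pos R11) (Suc n) $ Cartan_a $ y = ad_root_pow (Pos R11) n $ Root (Neg R11) $ y"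
  "ad_root_pow (Pos R11) (Suc n) $ Cartan_b $ y = 3 * ad_root_pow (Pos R11) n $ Root (Neg R11) $ y"
  "ad_root_pow (Pos R11) (Suc n) $ Root (Pos R10) $ y
      = ad_root_pow (Pos R11) n $ Root (Neg R01) $ y"
  "ad_root_pow (Pos R11) (Suc n) $ Root (Pos R01) $ y =
      - 3 * ad_root_pow (Pos R11) n $ Root (Neg R10) $ y"
  "ad_root_pow (Pos R11) (Suc n) $ Root (Pos R11) $ y = ad_root_pow (Pos R11) n $ Cartan_a $ y
      - ad_root_pow (Pos R11) n $ Cartan_b $ y"
  "ad_root_pow (Pos R11) (Suc n) $ Root (Pos R21) $ y =
      - 2 * ad_root_pow (Pos R11) n $ Root (Pos R10) $ y"
  "ad_root_pow (Pos R11) (Suc n) $ Root (Pos R31) $ y = 0"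
  "ad_root_pow (Pos R11) (Suc n) $ Root (Pos R32) $ y =
      - 3 * ad_root_pow (Pos R11) n $ Root (Pos R21) $ y"
  "ad_root_pow (Pos R11) (Suc n) $ Root (Neg R10) $ y
      = 2 * ad_root_pow (Pos R11) n $ Root (Neg R21) $ y"
  "ad_root_pow (Pos R11) (Suc n) $ Root (Neg R01) $ y = 0"
  "ad_root_pow (Pos R11) (Suc n) $ Root (Neg R11) $ y = 0"
  "ad_root_pow (Pos R11) (Suc n) $ Root (Neg R21) $ y
      = ad_root_pow (Pos R11) n $ Root (Neg R32) $ y"
  "ad_root_pow (Pos R11) (Suc n) $ Root (Neg R31) $ y = 0"
  "ad_root_pow (Pos R11) (Suc n) $ Root (Neg R32) $ y = 0"
  "ad_root_pow (Pos R21) (Suc n) $ Cartan_a $ y = 2 * ad_root_pow (Pos R21) n $ Root (Neg R21) $ y"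
  "ad_root_pow (Pos R21) (Suc n) $ Cartan_b $ y = 3 * ad_root_pow (Pos R21) n $ Root (Neg R21) $ y"
  "ad_root_pow (Pos R21) (Suc n) $ Root (Pos R10) $ y
      = 2 * ad_root_pow (Pos R21) n $ Root (Neg R11) $ y"
  "ad_root_pow (Pos R21) (Suc n) $ Root (Pos R01) $ y = 0"
  "ad_root_pow (Pos R21) (Suc n) $ Root (Pos R11) $ y =
      - 2 * ad_root_pow (Pos R21) n $ Root (Neg R10) $ y"
  "ad_root_pow (Pos R21) (Suc n) $ Root (Pos R21) $ y = - ad_root_pow (Pos R21) n $ Cartan_a $ y"
  "ad_root_pow (Pos R21) (Suc n) $ Root (Pos R31) $ y =
      - 3 * ad_root_pow (Pos R21) n $ Root (Pos R10) $ y"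
  "ad_root_pow (Pos R21) (Suc n) $ Root (Pos R32) $ y
      = 3 * ad_root_pow (Pos R21) n $ Root (Pos R11) $ y"
  "ad_root_pow (Pos R21) (Suc n) $ Root (Neg R10) $ y
      = ad_root_pow (Pos R21) n $ Root (Neg R31) $ y"
  "ad_root_pow (Pos R21) (Suc n) $ Root (Neg R01) $ y = 0"
  "ad_root_pow (Pos R21) (Suc n) $ Root (Neg R11) $ y =
      - ad_root_pow (Pos R21) n $ Root (Neg R32) $ y"
  "ad_root_pow (Pos R21) (Suc n) $ Root (Neg R21) $ y = 0"
  "ad_root_pow (Pos R21) (Suc n) $ Root (Neg R31) $ y = 0"
  "ad_root_pow (Pos R21) (Suc n) $ Root (Neg R32) $ y = 0"
  "ad_root_pow (Pos R31) (Suc n) $ Cartan_a $ y = ad_root_pow (Pos R31) n $ Root (Neg R31) $ y"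
  "ad_root_pow (Pos R31) (Suc n) $ Cartan_b $ y = ad_root_pow (Pos R31) n $ Root (Neg R31) $ y"
  "ad_root_pow (Pos R31) (Suc n) $ Root (Pos R10) $ y
      = ad_root_pow (Pos R31) n $ Root (Neg R21) $ y"
  "ad_root_pow (Pos R31) (Suc n) $ Root (Pos R01) $ y = 0"
  "ad_root_pow (Pos R31) (Suc n) $ Root (Pos R11) $ y = 0"
  "ad_root_pow (Pos R31) (Suc n) $ Root (Pos R21) $ y =
      - ad_root_pow (Pos R31) n $ Root (Neg R10) $ y"
  "ad_root_pow (Pos R31) (Suc n) $ Root (Pos R31) $ y =
      - 3 * ad_root_pow (Pos R31) n $ Cartan_a $ y + ad_root_pow (Pos R31) n $ Cartan_b $ y"
  "ad_root_pow (Pos R31) (Suc n) $ Root (Pos R32) $ y =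
      - ad_root_pow (Pos R31) n $ Root (Pos R01) $ y"
  "ad_root_pow (Pos R31) (Suc n) $ Root (Neg R10) $ y = 0"
  "ad_root_pow (Pos R31) (Suc n) $ Root (Neg R01) $ y
      = ad_root_pow (Pos R31) n $ Root (Neg R32) $ y"
  "ad_root_pow (Pos R31) (Suc n) $ Root (Neg R11) $ y = 0"
  "ad_root_pow (Pos R31) (Suc n) $ Root (Neg R21) $ y = 0"
  "ad_root_pow (Pos R31) (Suc n) $ Root (Neg R31) $ y = 0"
  "ad_root_pow (Pos R31) (Suc n) $ Root (Neg R32) $ y = 0"
  "ad_root_pow (Pos R32) (Suc n) $ Cartan_a $ y = ad_root_pow (Pos R32) n $ Root (Neg R32) $ y"
  "ad_root_pow (Pos R32) (Suc n) $ Cartan_b $ y = 2 * ad_root_pow (Pos R32) n $ Root (Neg R32) $ y"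
  "ad_root_pow (Pos R32) (Suc n) $ Root (Pos R10) $ y = 0"
  "ad_root_pow (Pos R32) (Suc n) $ Root (Pos R01) $ y
      = ad_root_pow (Pos R32) n $ Root (Neg R31) $ y"
  "ad_root_pow (Pos R32) (Suc n) $ Root (Pos R11) $ y =
      - ad_root_pow (Pos R32) n $ Root (Neg R21) $ y"
  "ad_root_pow (Pos R32) (Suc n) $ Root (Pos R21) $ y
      = ad_root_pow (Pos R32) n $ Root (Neg R11) $ y"
  "ad_root_pow (Pos R32) (Suc n) $ Root (Pos R31) $ y =
      - ad_root_pow (Pos R32) n $ Root (Neg R01) $ y"
  "ad_root_pow (Pos R32) (Suc n) $ Root (Pos R32) $ y = - ad_root_pow (Pos R32) n $ Cartan_b $ y"
  "ad_root_pow (Pos R32) (Suc n) $ Root (Neg R10) $ y = 0"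
  "ad_root_pow (Pos R32) (Suc n) $ Root (Neg R01) $ y = 0"
  "ad_root_pow (Pos R32) (Suc n) $ Root (Neg R11) $ y = 0"
  "ad_root_pow (Pos R32) (Suc n) $ Root (Neg R21) $ y = 0"
  "ad_root_pow (Pos R32) (Suc n) $ Root (Neg R31) $ y = 0"
  "ad_root_pow (Pos R32) (Suc n) $ Root (Neg R32) $ y = 0"
  "ad_root_pow (Neg R10) (Suc n) $ Cartan_a $ y = - ad_root_pow (Neg R10) n $ Root (Pos R10) $ y"
  "ad_root_pow (Neg R10) (Suc n) $ Cartan_b $ y = 0"
  "ad_root_pow (Neg R10) (Suc n) $ Root (Pos R10) $ y = 0"
  "ad_root_pow (Neg R10) (Suc n) $ Root (Pos R01) $ y
      = 3 * ad_root_pow (Neg R10) n $ Root (Pos R11) $ y"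
  "ad_root_pow (Neg R10) (Suc n) $ Root (Pos R11) $ y
      = 2 * ad_root_pow (Neg R10) n $ Root (Pos R21) $ y"
  "ad_root_pow (Neg R10) (Suc n) $ Root (Pos R21) $ y
      = ad_root_pow (Neg R10) n $ Root (Pos R31) $ y"
  "ad_root_pow (Neg R10) (Suc n) $ Root (Pos R31) $ y = 0"
  "ad_root_pow (Neg R10) (Suc n) $ Root (Pos R32) $ y = 0"
  "ad_root_pow (Neg R10) (Suc n) $ Root (Neg R10) $ y
      = 2 * ad_root_pow (Neg R10) n $ Cartan_a $ y - ad_root_pow (Neg R10) n $ Cartan_b $ y"
  "ad_root_pow (Neg R10) (Suc n) $ Root (Neg R01) $ y = 0"
  "ad_root_pow (Neg R10) (Suc n) $ Root (Neg R11) $ y =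
      - ad_root_pow (Neg R10) n $ Root (Neg R01) $ y"
  "ad_root_pow (Neg R10) (Suc n) $ Root (Neg R21) $ y =
      - 2 * ad_root_pow (Neg R10) n $ Root (Neg R11) $ y"
  "ad_root_pow (Neg R10) (Suc n) $ Root (Neg R31) $ y =
      - 3 * ad_root_pow (Neg R10) n $ Root (Neg R21) $ y"
  "ad_root_pow (Neg R10) (Suc n) $ Root (Neg R32) $ y = 0"
  "ad_root_pow (Neg R01) (Suc n) $ Cartan_a $ y = 0"
  "ad_root_pow (Neg R01) (Suc n) $ Cartan_b $ y = - ad_root_pow (Neg R01) n $ Root (Pos R01) $ y"
  "ad_root_pow (Neg R01) (Suc n) $ Root (Pos R10) $ y =
      - ad_root_pow (Neg R01) n $ Root (Pos R11) $ y"
  "ad_root_pow (Neg R01) (Suc n) $ Root (Pos R01) $ y = 0"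
  "ad_root_pow (Neg R01) (Suc n) $ Root (Pos R11) $ y = 0"
  "ad_root_pow (Neg R01) (Suc n) $ Root (Pos R21) $ y = 0"
  "ad_root_pow (Neg R01) (Suc n) $ Root (Pos R31) $ y
      = ad_root_pow (Neg R01) n $ Root (Pos R32) $ y"
  "ad_root_pow (Neg R01) (Suc n) $ Root (Pos R32) $ y = 0"
  "ad_root_pow (Neg R01) (Suc n) $ Root (Neg R10) $ y = 0"
  "ad_root_pow (Neg R01) (Suc n) $ Root (Neg R01) $ y =
      - 3 * ad_root_pow (Neg R01) n $ Cartan_a $ y + 2 * ad_root_pow (Neg R01) n $ Cartan_b $ y"
  "ad_root_pow (Neg R01) (Suc n) $ Root (Neg R11) $ y
      = ad_root_pow (Neg R01) n $ Root (Neg R10) $ y"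
  "ad_root_pow (Neg R01) (Suc n) $ Root (Neg R21) $ y = 0"
  "ad_root_pow (Neg R01) (Suc n) $ Root (Neg R31) $ y = 0"
  "ad_root_pow (Neg R01) (Suc n) $ Root (Neg R32) $ y =
      - ad_root_pow (Neg R01) n $ Root (Neg R31) $ y"
  "ad_root_pow (Neg R11) (Suc n) $ Cartan_a $ y = - ad_root_pow (Neg R11) n $ Root (Pos R11) $ y"
  "ad_root_pow (Neg R11) (Suc n) $ Cartan_b $ y =
      - 3 * ad_root_pow (Neg R11) n $ Root (Pos R11) $ y"
  "ad_root_pow (Neg R11) (Suc n) $ Root (Pos R10) $ y =
      - 2 * ad_root_pow (Neg R11) n $ Root (Pos R21) $ y"
  "ad_root_pow (Neg R11) (Suc n) $ Root (Pos R01) $ y = 0"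
  "ad_root_pow (Neg R11) (Suc n) $ Root (Pos R11) $ y = 0"
  "ad_root_pow (Neg R11) (Suc n) $ Root (Pos R21) $ y =
      - ad_root_pow (Neg R11) n $ Root (Pos R32) $ y"
  "ad_root_pow (Neg R11) (Suc n) $ Root (Pos R31) $ y = 0"
  "ad_root_pow (Neg R11) (Suc n) $ Root (Pos R32) $ y = 0"
  "ad_root_pow (Neg R11) (Suc n) $ Root (Neg R10) $ y =
      - ad_root_pow (Neg R11) n $ Root (Pos R01) $ y"
  "ad_root_pow (Neg R11) (Suc n) $ Root (Neg R01) $ y
      = 3 * ad_root_pow (Neg R11) n $ Root (Pos R10) $ y"
  "ad_root_pow (Neg R11) (Suc n) $ Root (Neg R11) $ y =
      - ad_root_pow (Neg R11) n $ Cartan_a $ y + ad_root_pow (Neg R11) n $ Cartan_b $ y"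
  "ad_root_pow (Neg R11) (Suc n) $ Root (Neg R21) $ y
      = 2 * ad_root_pow (Neg R11) n $ Root (Neg R10) $ y"
  "ad_root_pow (Neg R11) (Suc n) $ Root (Neg R31) $ y = 0"
  "ad_root_pow (Neg R11) (Suc n) $ Root (Neg R32) $ y
      = 3 * ad_root_pow (Neg R11) n $ Root (Neg R21) $ y"
  "ad_root_pow (Neg R21) (Suc n) $ Cartan_a $ y =
      - 2 * ad_root_pow (Neg R21) n $ Root (Pos R21) $ y"
  "ad_root_pow (Neg R21) (Suc n) $ Cartan_b $ y =
      - 3 * ad_root_pow (Neg R21) n $ Root (Pos R21) $ y"
  "ad_root_pow (Neg R21) (Suc n) $ Root (Pos R10) $ y =
      - ad_root_pow (Neg R21) n $ Root (Pos R31) $ y"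
  "ad_root_pow (Neg R21) (Suc n) $ Root (Pos R01) $ y = 0"
  "ad_root_pow (Neg R21) (Suc n) $ Root (Pos R11) $ y
      = ad_root_pow (Neg R21) n $ Root (Pos R32) $ y"
  "ad_root_pow (Neg R21) (Suc n) $ Root (Pos R21) $ y = 0"
  "ad_root_pow (Neg R21) (Suc n) $ Root (Pos R31) $ y = 0"
  "ad_root_pow (Neg R21) (Suc n) $ Root (Pos R32) $ y = 0"
  "ad_root_pow (Neg R21) (Suc n) $ Root (Neg R10) $ y =
      - 2 * ad_root_pow (Neg R21) n $ Root (Pos R11) $ y"
  "ad_root_pow (Neg R21) (Suc n) $ Root (Neg R01) $ y = 0"
  "ad_root_pow (Neg R21) (Suc n) $ Root (Neg R11) $ y
      = 2 * ad_root_pow (Neg R21) n $ Root (Pos R10) $ y"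
  "ad_root_pow (Neg R21) (Suc n) $ Root (Neg R21) $ y = ad_root_pow (Neg R21) n $ Cartan_a $ y"
  "ad_root_pow (Neg R21) (Suc n) $ Root (Neg R31) $ y
      = 3 * ad_root_pow (Neg R21) n $ Root (Neg R10) $ y"
  "ad_root_pow (Neg R21) (Suc n) $ Root (Neg R32) $ y =
      - 3 * ad_root_pow (Neg R21) n $ Root (Neg R11) $ y"
  "ad_root_pow (Neg R31) (Suc n) $ Cartan_a $ y = - ad_root_pow (Neg R31) n $ Root (Pos R31) $ y"
  "ad_root_pow (Neg R31) (Suc n) $ Cartan_b $ y = - ad_root_pow (Neg R31) n $ Root (Pos R31) $ y"
  "ad_root_pow (Neg R31) (Suc n) $ Root (Pos R10) $ y = 0"
  "ad_root_pow (Neg R31) (Suc n) $ Root (Pos R01) $ y =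
      - ad_root_pow (Neg R31) n $ Root (Pos R32) $ y"
  "ad_root_pow (Neg R31) (Suc n) $ Root (Pos R11) $ y = 0"
  "ad_root_pow (Neg R31) (Suc n) $ Root (Pos R21) $ y = 0"
  "ad_root_pow (Neg R31) (Suc n) $ Root (Pos R31) $ y = 0"
  "ad_root_pow (Neg R31) (Suc n) $ Root (Pos R32) $ y = 0"
  "ad_root_pow (Neg R31) (Suc n) $ Root (Neg R10) $ y =
      - ad_root_pow (Neg R31) n $ Root (Pos R21) $ y"
  "ad_root_pow (Neg R31) (Suc n) $ Root (Neg R01) $ y = 0"
  "ad_root_pow (Neg R31) (Suc n) $ Root (Neg R11) $ y = 0"
  "ad_root_pow (Neg R31) (Suc n) $ Root (Neg R21) $ y
      = ad_root_pow (Neg R31) n $ Root (Pos R10) $ y"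
  "ad_root_pow (Neg R31) (Suc n) $ Root (Neg R31) $ y
      = 3 * ad_root_pow (Neg R31) n $ Cartan_a $ y - ad_root_pow (Neg R31) n $ Cartan_b $ y"
  "ad_root_pow (Neg R31) (Suc n) $ Root (Neg R32) $ y
      = ad_root_pow (Neg R31) n $ Root (Neg R01) $ y"
  "ad_root_pow (Neg R32) (Suc n) $ Cartan_a $ y = - ad_root_pow (Neg R32) n $ Root (Pos R32) $ y"
  "ad_root_pow (Neg R32) (Suc n) $ Cartan_b $ y =
      - 2 * ad_root_pow (Neg R32) n $ Root (Pos R32) $ y"
  "ad_root_pow (Neg R32) (Suc n) $ Root (Pos R10) $ y = 0"
  "ad_root_pow (Neg R32) (Suc n) $ Root (Pos R01) $ y = 0"
  "ad_root_pow (Neg R32) (Suc n) $ Root (Pos R11) $ y = 0"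
  "ad_root_pow (Neg R32) (Suc n) $ Root (Pos R21) $ y = 0"
  "ad_root_pow (Neg R32) (Suc n) $ Root (Pos R31) $ y = 0"
  "ad_root_pow (Neg R32) (Suc n) $ Root (Pos R32) $ y = 0"
  "ad_root_pow (Neg R32) (Suc n) $ Root (Neg R10) $ y = 0"
  "ad_root_pow (Neg R32) (Suc n) $ Root (Neg R01) $ y =
      - ad_root_pow (Neg R32) n $ Root (Pos R31) $ y"
  "ad_root_pow (Neg R32) (Suc n) $ Root (Neg R11) $ y
      = ad_root_pow (Neg R32) n $ Root (Pos R21) $ y"
  "ad_root_pow (Neg R32) (Suc n) $ Root (Neg R21) $ y =
      - ad_root_pow (Neg R32) n $ Root (Pos R11) $ y"
  "ad_root_pow (Neg R32) (Suc n) $ Root (Neg R31) $ y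
      = ad_root_pow (Neg R32) n $ Root (Pos R01) $ y"
  "ad_root_pow (Neg R32) (Suc n) $ Root (Neg R32) $ y = ad_root_pow (Neg R32) n $ Cartan_b $ y"
  by (simp_all add: ad_root_pow_Suc sum_g2_basis zero_prod_def)

text \<open>Along a root string of four roots the cube of \<open>ad (e r)\<close> has entries 6 or
  -6; division by \<open>fact 3\<close> leaves the coefficients 1 and -1 of
  \<open>t^3\<close>.\<close>

lemma root_element_nth [simp]:
  fixes x :: "'k::field ^ g2_basis"
  shows
  "(root_element (Pos R10) t *v x) $ Cartan_a = x $ Cartan_a + t * x $ Root (Neg R10)"
  "(root_element (Pos R10) t *v x) $ Cartan_b = x $ Cartan_b"
  "(root_element (Pos R10) t *v x) $ Root (Pos R10) = x $ Root (Pos R10)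
      - 2 * (t * x $ Cartan_a) + t * x $ Cartan_b - t^2 * x $ Root (Neg R10)"
  "(root_element (Pos R10) t *v x) $ Root (Pos R01) = x $ Root (Pos R01)"
  "(root_element (Pos R10) t *v x) $ Root (Pos R11) = x $ Root (Pos R11) + t * x $ Root (Pos R01)"
  "(root_element (Pos R10) t *v x) $ Root (Pos R21) = x $ Root (Pos R21)
      + 2 * (t * x $ Root (Pos R11)) + t^2 * x $ Root (Pos R01)"
  "(root_element (Pos R10) t *v x) $ Root (Pos R31) = x $ Root (Pos R31)
      + 3 * (t * x $ Root (Pos R21)) + 3 * (t^2 * x $ Root (Pos R11)) + t^3 * x $ Root (Pos R01)"
  "(root_element (Pos R10) t *v x) $ Root (Pos R32) = x $ Root (Pos R32)"
  "(root_element (Pos R10) t *v x) $ Root (Neg R10) = x $ Root (Neg R10)"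
  "(root_element (Pos R10) t *v x) $ Root (Neg R01) = x $ Root (Neg R01)
      - 3 * (t * x $ Root (Neg R11)) + 3 * (t^2 * x $ Root (Neg R21)) - t^3 * x $ Root (Neg R31)"
  "(root_element (Pos R10) t *v x) $ Root (Neg R11) = x $ Root (Neg R11)
      - 2 * (t * x $ Root (Neg R21)) + t^2 * x $ Root (Neg R31)"
  "(root_element (Pos R10) t *v x) $ Root (Neg R21) = x $ Root (Neg R21) - t * x $ Root (Neg R31)"
  "(root_element (Pos R10) t *v x) $ Root (Neg R31) = x $ Root (Neg R31)"
  "(root_element (Pos R10) t *v x) $ Root (Neg R32) = x $ Root (Neg R32)"
  "(root_element (Pos R01) t *v x) $ Cartan_a = x $ Cartan_a"
  "(root_element (Pos R01) t *v x) $ Cartan_b = x $ Cartan_b + t * x $ Root (Neg R01)"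
  "(root_element (Pos R01) t *v x) $ Root (Pos R10) = x $ Root (Pos R10)"
  "(root_element (Pos R01) t *v x) $ Root (Pos R01) = x $ Root (Pos R01)
      - 2 * (t * x $ Cartan_b) + 3 * (t * x $ Cartan_a) - t^2 * x $ Root (Neg R01)"
  "(root_element (Pos R01) t *v x) $ Root (Pos R11) = x $ Root (Pos R11) - t * x $ Root (Pos R10)"
  "(root_element (Pos R01) t *v x) $ Root (Pos R21) = x $ Root (Pos R21)"
  "(root_element (Pos R01) t *v x) $ Root (Pos R31) = x $ Root (Pos R31)"
  "(root_element (Pos R01) t *v x) $ Root (Pos R32) = x $ Root (Pos R32) + t * x $ Root (Pos R31)"
  "(root_element (Pos R01) t *v x) $ Root (Neg R10) = x $ Root (Neg R10) + t * x $ Root (Neg R11)"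
  "(root_element (Pos R01) t *v x) $ Root (Neg R01) = x $ Root (Neg R01)"
  "(root_element (Pos R01) t *v x) $ Root (Neg R11) = x $ Root (Neg R11)"
  "(root_element (Pos R01) t *v x) $ Root (Neg R21) = x $ Root (Neg R21)"
  "(root_element (Pos R01) t *v x) $ Root (Neg R31) = x $ Root (Neg R31) - t * x $ Root (Neg R32)"
  "(root_element (Pos R01) t *v x) $ Root (Neg R32) = x $ Root (Neg R32)"
  "(root_element (Pos R11) t *v x) $ Cartan_a = x $ Cartan_a + t * x $ Root (Neg R11)"
  "(root_element (Pos R11) t *v x) $ Cartan_b = x $ Cartan_b + 3 * (t * x $ Root (Neg R11))"
  "(root_element (Pos R11) t *v x) $ Root (Pos R10) = x $ Root (Pos R10) + t * x $ Root (Neg R01)"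
  "(root_element (Pos R11) t *v x) $ Root (Pos R01) = x $ Root (Pos R01)
      - 3 * (t * x $ Root (Neg R10)) - 3 * (t^2 * x $ Root (Neg R21)) - t^3 * x $ Root (Neg R32)"
  "(root_element (Pos R11) t *v x) $ Root (Pos R11) = x $ Root (Pos R11) - t * x $ Cartan_b
      + t * x $ Cartan_a - t^2 * x $ Root (Neg R11)"
  "(root_element (Pos R11) t *v x) $ Root (Pos R21) = x $ Root (Pos R21)
      - 2 * (t * x $ Root (Pos R10)) - t^2 * x $ Root (Neg R01)"
  "(root_element (Pos R11) t *v x) $ Root (Pos R31) = x $ Root (Pos R31)"
  "(root_element (Pos R11) t *v x) $ Root (Pos R32) = x $ Root (Pos R32)
      - 3 * (t * x $ Root (Pos R21)) + 3 * (t^2 * x $ Root (Pos R10)) + t^3 * x $ Root (Neg R01)"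
  "(root_element (Pos R11) t *v x) $ Root (Neg R10) = x $ Root (Neg R10)
      + 2 * (t * x $ Root (Neg R21)) + t^2 * x $ Root (Neg R32)"
  "(root_element (Pos R11) t *v x) $ Root (Neg R01) = x $ Root (Neg R01)"
  "(root_element (Pos R11) t *v x) $ Root (Neg R11) = x $ Root (Neg R11)"
  "(root_element (Pos R11) t *v x) $ Root (Neg R21) = x $ Root (Neg R21) + t * x $ Root (Neg R32)"
  "(root_element (Pos R11) t *v x) $ Root (Neg R31) = x $ Root (Neg R31)"
  "(root_element (Pos R11) t *v x) $ Root (Neg R32) = x $ Root (Neg R32)"
  "(root_element (Pos R21) t *v x) $ Cartan_a = x $ Cartan_a + 2 * (t * x $ Root (Neg R21))"
  "(root_element (Pos R21) t *v x) $ Cartan_b = x $ Cartan_b + 3 * (t * x $ Root (Neg R21))"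
  "(root_element (Pos R21) t *v x) $ Root (Pos R10) = x $ Root (Pos R10)
      + 2 * (t * x $ Root (Neg R11)) - t^2 * x $ Root (Neg R32)"
  "(root_element (Pos R21) t *v x) $ Root (Pos R01) = x $ Root (Pos R01)"
  "(root_element (Pos R21) t *v x) $ Root (Pos R11) = x $ Root (Pos R11)
      - 2 * (t * x $ Root (Neg R10)) - t^2 * x $ Root (Neg R31)"
  "(root_element (Pos R21) t *v x) $ Root (Pos R21) = x $ Root (Pos R21) - t * x $ Cartan_a
      - t^2 * x $ Root (Neg R21)"
  "(root_element (Pos R21) t *v x) $ Root (Pos R31) = x $ Root (Pos R31)
      - 3 * (t * x $ Root (Pos R10)) - 3 * (t^2 * x $ Root (Neg R11)) + t^3 * x $ Root (Neg R32)"
  "(root_element (Pos R21) t *v x) $ Root (Pos R32) = x $ Root (Pos R32)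
      + 3 * (t * x $ Root (Pos R11)) - 3 * (t^2 * x $ Root (Neg R10)) - t^3 * x $ Root (Neg R31)"
  "(root_element (Pos R21) t *v x) $ Root (Neg R10) = x $ Root (Neg R10) + t * x $ Root (Neg R31)"
  "(root_element (Pos R21) t *v x) $ Root (Neg R01) = x $ Root (Neg R01)"
  "(root_element (Pos R21) t *v x) $ Root (Neg R11) = x $ Root (Neg R11) - t * x $ Root (Neg R32)"
  "(root_element (Pos R21) t *v x) $ Root (Neg R21) = x $ Root (Neg R21)"
  "(root_element (Pos R21) t *v x) $ Root (Neg R31) = x $ Root (Neg R31)"
  "(root_element (Pos R21) t *v x) $ Root (Neg R32) = x $ Root (Neg R32)"
  "(root_element (Pos R31) t *v x) $ Cartan_a = x $ Cartan_a + t * x $ Root (Neg R31)"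
  "(root_element (Pos R31) t *v x) $ Cartan_b = x $ Cartan_b + t * x $ Root (Neg R31)"
  "(root_element (Pos R31) t *v x) $ Root (Pos R10) = x $ Root (Pos R10) + t * x $ Root (Neg R21)"
  "(root_element (Pos R31) t *v x) $ Root (Pos R01) = x $ Root (Pos R01)"
  "(root_element (Pos R31) t *v x) $ Root (Pos R11) = x $ Root (Pos R11)"
  "(root_element (Pos R31) t *v x) $ Root (Pos R21) = x $ Root (Pos R21) - t * x $ Root (Neg R10)"
  "(root_element (Pos R31) t *v x) $ Root (Pos R31) = x $ Root (Pos R31)
      - 3 * (t * x $ Cartan_a) + t * x $ Cartan_b - t^2 * x $ Root (Neg R31)"
  "(root_element (Pos R31) t *v x) $ Root (Pos R32) = x $ Root (Pos R32) - t * x $ Root (Pos R01)"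
  "(root_element (Pos R31) t *v x) $ Root (Neg R10) = x $ Root (Neg R10)"
  "(root_element (Pos R31) t *v x) $ Root (Neg R01) = x $ Root (Neg R01) + t * x $ Root (Neg R32)"
  "(root_element (Pos R31) t *v x) $ Root (Neg R11) = x $ Root (Neg R11)"
  "(root_element (Pos R31) t *v x) $ Root (Neg R21) = x $ Root (Neg R21)"
  "(root_element (Pos R31) t *v x) $ Root (Neg R31) = x $ Root (Neg R31)"
  "(root_element (Pos R31) t *v x) $ Root (Neg R32) = x $ Root (Neg R32)"
  "(root_element (Pos R32) t *v x) $ Cartan_a = x $ Cartan_a + t * x $ Root (Neg R32)"
  "(root_element (Pos R32) t *v x) $ Cartan_b = x $ Cartan_b + 2 * (t * x $ Root (Neg R32))"
  "(root_element (Pos R32) t *v x) $ Root (Pos R10) = x $ Root (Pos R10)"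
  "(root_element (Pos R32) t *v x) $ Root (Pos R01) = x $ Root (Pos R01) + t * x $ Root (Neg R31)"
  "(root_element (Pos R32) t *v x) $ Root (Pos R11) = x $ Root (Pos R11) - t * x $ Root (Neg R21)"
  "(root_element (Pos R32) t *v x) $ Root (Pos R21) = x $ Root (Pos R21) + t * x $ Root (Neg R11)"
  "(root_element (Pos R32) t *v x) $ Root (Pos R31) = x $ Root (Pos R31) - t * x $ Root (Neg R01)"
  "(root_element (Pos R32) t *v x) $ Root (Pos R32) = x $ Root (Pos R32) - t * x $ Cartan_b
      - t^2 * x $ Root (Neg R32)"
  "(root_element (Pos R32) t *v x) $ Root (Neg R10) = x $ Root (Neg R10)"
  "(root_element (Pos R32) t *v x) $ Root (Neg R01) = x $ Root (Neg R01)"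
  "(root_element (Pos R32) t *v x) $ Root (Neg R11) = x $ Root (Neg R11)"
  "(root_element (Pos R32) t *v x) $ Root (Neg R21) = x $ Root (Neg R21)"
  "(root_element (Pos R32) t *v x) $ Root (Neg R31) = x $ Root (Neg R31)"
  "(root_element (Pos R32) t *v x) $ Root (Neg R32) = x $ Root (Neg R32)"
  "(root_element (Neg R10) t *v x) $ Cartan_a = x $ Cartan_a - t * x $ Root (Pos R10)"
  "(root_element (Neg R10) t *v x) $ Cartan_b = x $ Cartan_b"
  "(root_element (Neg R10) t *v x) $ Root (Pos R10) = x $ Root (Pos R10)"
  "(root_element (Neg R10) t *v x) $ Root (Pos R01) = x $ Root (Pos R01)
      + 3 * (t * x $ Root (Pos R11)) + 3 * (t^2 * x $ Root (Pos R21)) + t^3 * x $ Root (Pos R31)"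
  "(root_element (Neg R10) t *v x) $ Root (Pos R11) = x $ Root (Pos R11)
      + 2 * (t * x $ Root (Pos R21)) + t^2 * x $ Root (Pos R31)"
  "(root_element (Neg R10) t *v x) $ Root (Pos R21) = x $ Root (Pos R21) + t * x $ Root (Pos R31)"
  "(root_element (Neg R10) t *v x) $ Root (Pos R31) = x $ Root (Pos R31)"
  "(root_element (Neg R10) t *v x) $ Root (Pos R32) = x $ Root (Pos R32)"
  "(root_element (Neg R10) t *v x) $ Root (Neg R10) = x $ Root (Neg R10) - t * x $ Cartan_b
      + 2 * (t * x $ Cartan_a) - t^2 * x $ Root (Pos R10)"
  "(root_element (Neg R10) t *v x) $ Root (Neg R01) = x $ Root (Neg R01)"
  "(root_element (Neg R10) t *v x) $ Root (Neg R11) = x $ Root (Neg R11) - t * x $ Root (Neg R01)"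
  "(root_element (Neg R10) t *v x) $ Root (Neg R21) = x $ Root (Neg R21)
      - 2 * (t * x $ Root (Neg R11)) + t^2 * x $ Root (Neg R01)"
  "(root_element (Neg R10) t *v x) $ Root (Neg R31) = x $ Root (Neg R31)
      - 3 * (t * x $ Root (Neg R21)) + 3 * (t^2 * x $ Root (Neg R11)) - t^3 * x $ Root (Neg R01)"
  "(root_element (Neg R10) t *v x) $ Root (Neg R32) = x $ Root (Neg R32)"
  "(root_element (Neg R01) t *v x) $ Cartan_a = x $ Cartan_a"
  "(root_element (Neg R01) t *v x) $ Cartan_b = x $ Cartan_b - t * x $ Root (Pos R01)"
  "(root_element (Neg R01) t *v x) $ Root (Pos R10) = x $ Root (Pos R10) - t * x $ Root (Pos R11)"
  "(root_element (Neg R01) t *v x) $ Root (Pos R01) = x $ Root (Pos R01)"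
  "(root_element (Neg R01) t *v x) $ Root (Pos R11) = x $ Root (Pos R11)"
  "(root_element (Neg R01) t *v x) $ Root (Pos R21) = x $ Root (Pos R21)"
  "(root_element (Neg R01) t *v x) $ Root (Pos R31) = x $ Root (Pos R31) + t * x $ Root (Pos R32)"
  "(root_element (Neg R01) t *v x) $ Root (Pos R32) = x $ Root (Pos R32)"
  "(root_element (Neg R01) t *v x) $ Root (Neg R10) = x $ Root (Neg R10)"
  "(root_element (Neg R01) t *v x) $ Root (Neg R01) = x $ Root (Neg R01)
      - 3 * (t * x $ Cartan_a) + 2 * (t * x $ Cartan_b) - t^2 * x $ Root (Pos R01)"
  "(root_element (Neg R01) t *v x) $ Root (Neg R11) = x $ Root (Neg R11) + t * x $ Root (Neg R10)"
  "(root_element (Neg R01) t *v x) $ Root (Neg R21) = x $ Root (Neg R21)"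
  "(root_element (Neg R01) t *v x) $ Root (Neg R31) = x $ Root (Neg R31)"
  "(root_element (Neg R01) t *v x) $ Root (Neg R32) = x $ Root (Neg R32) - t * x $ Root (Neg R31)"
  "(root_element (Neg R11) t *v x) $ Cartan_a = x $ Cartan_a - t * x $ Root (Pos R11)"
  "(root_element (Neg R11) t *v x) $ Cartan_b = x $ Cartan_b - 3 * (t * x $ Root (Pos R11))"
  "(root_element (Neg R11) t *v x) $ Root (Pos R10) = x $ Root (Pos R10)
      - 2 * (t * x $ Root (Pos R21)) + t^2 * x $ Root (Pos R32)"
  "(root_element (Neg R11) t *v x) $ Root (Pos R01) = x $ Root (Pos R01)"
  "(root_element (Neg R11) t *v x) $ Root (Pos R11) = x $ Root (Pos R11)"
  "(root_element (Neg R11) t *v x) $ Root (Pos R21) = x $ Root (Pos R21) - t * x $ Root (Pos R32)"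
  "(root_element (Neg R11) t *v x) $ Root (Pos R31) = x $ Root (Pos R31)"
  "(root_element (Neg R11) t *v x) $ Root (Pos R32) = x $ Root (Pos R32)"
  "(root_element (Neg R11) t *v x) $ Root (Neg R10) = x $ Root (Neg R10) - t * x $ Root (Pos R01)"
  "(root_element (Neg R11) t *v x) $ Root (Neg R01) = x $ Root (Neg R01)
      + 3 * (t * x $ Root (Pos R10)) - 3 * (t^2 * x $ Root (Pos R21)) + t^3 * x $ Root (Pos R32)"
  "(root_element (Neg R11) t *v x) $ Root (Neg R11) = x $ Root (Neg R11) - t * x $ Cartan_a
      + t * x $ Cartan_b - t^2 * x $ Root (Pos R11)"
  "(root_element (Neg R11) t *v x) $ Root (Neg R21) = x $ Root (Neg R21)
      + 2 * (t * x $ Root (Neg R10)) - t^2 * x $ Root (Pos R01)"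
  "(root_element (Neg R11) t *v x) $ Root (Neg R31) = x $ Root (Neg R31)"
  "(root_element (Neg R11) t *v x) $ Root (Neg R32) = x $ Root (Neg R32)
      + 3 * (t * x $ Root (Neg R21)) + 3 * (t^2 * x $ Root (Neg R10)) - t^3 * x $ Root (Pos R01)"
  "(root_element (Neg R21) t *v x) $ Cartan_a = x $ Cartan_a - 2 * (t * x $ Root (Pos R21))"
  "(root_element (Neg R21) t *v x) $ Cartan_b = x $ Cartan_b - 3 * (t * x $ Root (Pos R21))"
  "(root_element (Neg R21) t *v x) $ Root (Pos R10) = x $ Root (Pos R10) - t * x $ Root (Pos R31)"
  "(root_element (Neg R21) t *v x) $ Root (Pos R01) = x $ Root (Pos R01)"
  "(root_element (Neg R21) t *v x) $ Root (Pos R11) = x $ Root (Pos R11) + t * x $ Root (Pos R32)"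
  "(root_element (Neg R21) t *v x) $ Root (Pos R21) = x $ Root (Pos R21)"
  "(root_element (Neg R21) t *v x) $ Root (Pos R31) = x $ Root (Pos R31)"
  "(root_element (Neg R21) t *v x) $ Root (Pos R32) = x $ Root (Pos R32)"
  "(root_element (Neg R21) t *v x) $ Root (Neg R10) = x $ Root (Neg R10)
      - 2 * (t * x $ Root (Pos R11)) - t^2 * x $ Root (Pos R32)"
  "(root_element (Neg R21) t *v x) $ Root (Neg R01) = x $ Root (Neg R01)"
  "(root_element (Neg R21) t *v x) $ Root (Neg R11) = x $ Root (Neg R11)
      + 2 * (t * x $ Root (Pos R10)) - t^2 * x $ Root (Pos R31)"
  "(root_element (Neg R21) t *v x) $ Root (Neg R21) = x $ Root (Neg R21) + t * x $ Cartan_a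
      - t^2 * x $ Root (Pos R21)"
  "(root_element (Neg R21) t *v x) $ Root (Neg R31) = x $ Root (Neg R31)
      + 3 * (t * x $ Root (Neg R10)) - 3 * (t^2 * x $ Root (Pos R11)) - t^3 * x $ Root (Pos R32)"
  "(root_element (Neg R21) t *v x) $ Root (Neg R32) = x $ Root (Neg R32)
      - 3 * (t * x $ Root (Neg R11)) - 3 * (t^2 * x $ Root (Pos R10)) + t^3 * x $ Root (Pos R31)"
  "(root_element (Neg R31) t *v x) $ Cartan_a = x $ Cartan_a - t * x $ Root (Pos R31)"
  "(root_element (Neg R31) t *v x) $ Cartan_b = x $ Cartan_b - t * x $ Root (Pos R31)"
  "(root_element (Neg R31) t *v x) $ Root (Pos R10) = x $ Root (Pos R10)"
  "(root_element (Neg R31) t *v x) $ Root (Pos R01) = x $ Root (Pos R01) - t * x $ Root (Pos R32)"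
  "(root_element (Neg R31) t *v x) $ Root (Pos R11) = x $ Root (Pos R11)"
  "(root_element (Neg R31) t *v x) $ Root (Pos R21) = x $ Root (Pos R21)"
  "(root_element (Neg R31) t *v x) $ Root (Pos R31) = x $ Root (Pos R31)"
  "(root_element (Neg R31) t *v x) $ Root (Pos R32) = x $ Root (Pos R32)"
  "(root_element (Neg R31) t *v x) $ Root (Neg R10) = x $ Root (Neg R10) - t * x $ Root (Pos R21)"
  "(root_element (Neg R31) t *v x) $ Root (Neg R01) = x $ Root (Neg R01)"
  "(root_element (Neg R31) t *v x) $ Root (Neg R11) = x $ Root (Neg R11)"
  "(root_element (Neg R31) t *v x) $ Root (Neg R21) = x $ Root (Neg R21) + t * x $ Root (Pos R10)"
  "(root_element (Neg R31) t *v x) $ Root (Neg R31) = x $ Root (Neg R31) - t * x $ Cartan_b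
      + 3 * (t * x $ Cartan_a) - t^2 * x $ Root (Pos R31)"
  "(root_element (Neg R31) t *v x) $ Root (Neg R32) = x $ Root (Neg R32) + t * x $ Root (Neg R01)"
  "(root_element (Neg R32) t *v x) $ Cartan_a = x $ Cartan_a - t * x $ Root (Pos R32)"
  "(root_element (Neg R32) t *v x) $ Cartan_b = x $ Cartan_b - 2 * (t * x $ Root (Pos R32))"
  "(root_element (Neg R32) t *v x) $ Root (Pos R10) = x $ Root (Pos R10)"
  "(root_element (Neg R32) t *v x) $ Root (Pos R01) = x $ Root (Pos R01)"
  "(root_element (Neg R32) t *v x) $ Root (Pos R11) = x $ Root (Pos R11)"
  "(root_element (Neg R32) t *v x) $ Root (Pos R21) = x $ Root (Pos R21)"
  "(root_element (Neg R32) t *v x) $ Root (Pos R31) = x $ Root (Pos R31)"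
  "(root_element (Neg R32) t *v x) $ Root (Pos R32) = x $ Root (Pos R32)"
  "(root_element (Neg R32) t *v x) $ Root (Neg R10) = x $ Root (Neg R10)"
  "(root_element (Neg R32) t *v x) $ Root (Neg R01) = x $ Root (Neg R01) - t * x $ Root (Pos R31)"
  "(root_element (Neg R32) t *v x) $ Root (Neg R11) = x $ Root (Neg R11) + t * x $ Root (Pos R21)"
  "(root_element (Neg R32) t *v x) $ Root (Neg R21) = x $ Root (Neg R21) - t * x $ Root (Pos R11)"
  "(root_element (Neg R32) t *v x) $ Root (Neg R31) = x $ Root (Neg R31) + t * x $ Root (Pos R01)"
  "(root_element (Neg R32) t *v x) $ Root (Neg R32) = x $ Root (Neg R32) + t * x $ Cartan_b
      - t^2 * x $ Root (Pos R32)"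
  by (simp_all add: root_element_def matrix_vector_mult_def sum_g2_basis eval_nat_numeral
      algebra_simps)


section \<open>Elements of the Chevalley group are Lie algebra automorphisms\<close>

text \<open>The exponential of a nilpotent derivation is an automorphism. After the division by
  factorials this is a polynomial identity with integer coefficients, hence valid over every
  field.\<close>

lemma root_element_lie:
  fixes x y :: "'k::field ^ g2_basis"
  shows "root_element r t *v lie x y = lie (root_element r t *v x) (root_element r t *v y)"
proof (cases r)
  case (Pos p)
  then show ?thesis unfolding vec_eq_iff all_g2_basis
    by (cases p; intro conjI) (simp_all add: algebra_simps power2_eq_square power3_eq_cube)
next
  case (Neg p)
  then show ?thesis unfolding vec_eq_iff all_g2_basis
    by (cases p; intro conjI) (simp_all add: algebra_simps power2_eq_square power3_eq_cube)
qed

lemma root_element_uminus: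
  fixes t :: "'k::field"
  shows "root_element r t ** root_element r (- t) = mat 1"
proof -
  have "root_element r t *v (root_element r (- t) *v x) = x" for x :: "'k ^ g2_basis"
  proof (cases r)
    case (Pos p)
    then show ?thesis unfolding vec_eq_iff all_g2_basis
      by (cases p; intro conjI) (simp_all add: algebra_simps power2_eq_square power3_eq_cube)
  next
    case (Neg p)
    then show ?thesis unfolding vec_eq_iff all_g2_basis
      by (cases p; intro conjI) (simp_all add: algebra_simps power2_eq_square power3_eq_cube)
  qed
  then show ?thesis by (simp add: matrix_eq matrix_vector_mul_assoc[symmetric])
qed

lemma invertible_root_element: "invertible (root_element r t)"
  using root_element_uminus[of r t] root_element_uminus[of r "- t"] by (auto simp: invertible_def)

definition lie_automorphism :: "'k::field ^ g2_basis ^ g2_basis \<Rightarrow> bool" where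
  "lie_automorphism A \<longleftrightarrow> invertible A \<and> (\<forall>x y. A *v lie x y = lie (A *v x) (A *v y))"

section \<open>The general linear group and the Chevalley group inside it\<close>

lemma GL_simps [simp]:
  "carrier GL = {A. invertible A}" "A \<otimes>\<^bsub>GL\<^esub> B = A ** B" "\<one>\<^bsub>GL\<^esub> = mat 1"
  by (simp_all add: GL_def)

lemma group_GL: "group (GL :: ('k::field ^ 'n ^ 'n) monoid)"
proof (rule groupI)
  fix A :: "'k ^ 'n ^ 'n" assume "A \<in> carrier GL"
  then obtain B where "A ** B = mat 1" "B ** A = mat 1" by (auto simp: invertible_def)
  then show "\<exists>B\<in>carrier GL. B \<otimes>\<^bsub>GL\<^esub> A = \<one>\<^bsub>GL\<^esub>" by (auto simp: invertible_def)
qed (auto simp: invertible_mult matrix_mul_assoc invertible_def[of "mat 1"])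

lemma subgroup_G2: "subgroup (carrier chevalley_G2) (GL :: ('k::field ^ g2_basis ^ g2_basis) monoid)"
proof -
  have "range (\<lambda>(r, t). root_element r t :: 'k ^ g2_basis ^ g2_basis) \<subseteq> carrier GL"
    by (auto simp: invertible_root_element)
  from group.generate_is_subgroup[OF group_GL this] show ?thesis
    by (simp add: chevalley_G2_def)
qed

lemma group_G2: "group (chevalley_G2 :: ('k::field ^ g2_basis ^ g2_basis) monoid)"
  using group.subgroup_imp_group[OF group_GL subgroup_G2] by (simp add: chevalley_G2_def)

lemma G2_simps [simp]:
  "A \<otimes>\<^bsub>chevalley_G2\<^esub> B = A ** B" "\<one>\<^bsub>chevalley_G2\<^esub> = mat 1"
  by (simp_all add: chevalley_G2_def)

lemma root_element_in_G2: "root_element r t \<in> carrier chevalley_G2"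
  unfolding chevalley_G2_def by (auto intro!: generate.incl)

lemma lie_automorphism_inverse:
  assumes "lie_automorphism A" and "A ** B = mat 1"
  shows "lie_automorphism B"
proof -
  have BA: "B ** A = mat 1" using assms(2) by (simp add: matrix_left_right_inverse)
  have AB: "A *v (B *v x) = x" "B *v (A *v x) = x" for x
    using assms(2) BA by (simp_all add: matrix_vector_mul_assoc)
  have "B *v lie x y = lie (B *v x) (B *v y)" for x y
    using assms(1) AB by (metis lie_automorphism_def)
  moreover have "invertible B" using assms(2) BA by (auto simp: invertible_def)
  ultimately show ?thesis by (simp add: lie_automorphism_def)
qed

text \<open>Membership in the group enters the nonexistence argument only through this property,
  which passes from root elements to products and inverses.\<close>

lemma G2_lie_automorphism:
  assumes "A \<in> carrier chevalley_G2"
  shows "lie_automorphism A"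
proof -
  have root: "lie_automorphism (root_element r t)" for r and t :: 'a
    by (simp add: lie_automorphism_def invertible_root_element root_element_lie)
  have "A \<in> generate GL (range (\<lambda>(r, t). root_element r t))"
    using assms by (simp add: chevalley_G2_def)
  then show ?thesis
  proof induction
    case one
    then show ?case by (auto simp: lie_automorphism_def invertible_def[of "mat 1"])
  next
    case (incl h)
    then show ?case using root by auto
  next
    case (inv h)
    then have h: "lie_automorphism h" using root by auto
    then have "h ** inv\<^bsub>GL\<^esub> h = mat 1"
      using group.r_inv[OF group_GL, of h] by (simp add: lie_automorphism_def)
    then show ?case using h lie_automorphism_inverse by blast
  next
    case (eng h1 h2)
    then show ?case
      by (simp add: lie_automorphism_def invertible_mult flip: matrix_vector_mul_assoc)
  qed
qed


section \<open>The field with five elements\<close>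

text \<open>Numerals are rewritten to 0, ..., 4, which turns arithmetic modulo 5 into
  rewriting.\<close>

lemma gf5_numeral [simp]:
  "(5::gf5) = 0" "(6::gf5) = 1" "(7::gf5) = 2" "(8::gf5) = 3" "(9::gf5) = 4"
  "(10::gf5) = 0" "(11::gf5) = 1" "(12::gf5) = 2" "(13::gf5) = 3" "(14::gf5) = 4"
  "(15::gf5) = 0" "(16::gf5) = 1" "(17::gf5) = 2" "(18::gf5) = 3" "(19::gf5) = 4"
  "(- 1::gf5) = 4" "(- 2::gf5) = 3" "(- 3::gf5) = 2" "(- 4::gf5) = 1"
proof -
  have 5: "(5::gf5) = 0"
    using of_nat_card_eq_0[where 'a = five] by (simp add: CARD_five)
  have *: "a = b" if "a = b + 5 * c" for a b c :: gf5
    using that 5 by simp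
  show "(5::gf5) = 0" by (rule 5)
  show "(6::gf5) = 1" "(7::gf5) = 2" "(8::gf5) = 3" "(9::gf5) = 4" "(10::gf5) = 0"
    by (rule *[where c = 1], simp; fail | rule *[where c = 2], simp)+
  show  "(11::gf5) = 1" "(12::gf5) = 2" "(13::gf5) = 3" "(14::gf5) = 4"
  "(15::gf5) = 0" "(16::gf5) = 1" "(17::gf5) = 2" "(18::gf5) = 3" "(19::gf5) = 4"
    by (rule *[where c = 2], simp; fail | rule *[where c = 3], simp)+
  show  "(- 1::gf5) = 4" "(- 2::gf5) = 3" "(- 3::gf5) = 2" "(- 4::gf5) = 1"
    by (rule *[where c = "- 1"], simp)+
qed

lemma gf5_numeral_neq_0 [simp]: "(2::gf5) \<noteq> 0" "(3::gf5) \<noteq> 0" "(4::gf5) \<noteq> 0"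
  using of_nat_0_mod_ring_dvd[where 'a = five, of 2] of_nat_0_mod_ring_dvd[where 'a = five, of 3]
    of_nat_0_mod_ring_dvd[where 'a = five, of 4]
  by (auto simp: CARD_five)

lemma gf5_cases:
  fixes x :: gf5
  obtains "x = 0" | "x = 1" | "x = 2" | "x = 3" | "x = 4"
proof -
  obtain i where "i < 5" "x = of_nat i"
    using surj_of_nat_mod_ring[of x] by (auto simp: CARD_five)
  moreover have "i = 0 \<or> i = 1 \<or> i = 2 \<or> i = 3 \<or> i = 4" using \<open>i < 5\<close> by linarith
  ultimately show thesis using that by auto
qed

lemma gf5_distinct [simp]:
  "(1::gf5) \<noteq> 2" "(1::gf5) \<noteq> 3" "(1::gf5) \<noteq> 4" "(2::gf5) \<noteq> 3" "(2::gf5) \<noteq> 4" "(3::gf5) \<noteq> 4"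
  "(0::gf5) \<noteq> 2" "(0::gf5) \<noteq> 3" "(0::gf5) \<noteq> 4"
  "(2::gf5) \<noteq> 1" "(3::gf5) \<noteq> 1" "(4::gf5) \<noteq> 1" "(3::gf5) \<noteq> 2" "(4::gf5) \<noteq> 2" "(4::gf5) \<noteq> 3"
proof -
  have *: "a \<noteq> b" if "b - a \<noteq> 0" for a b :: gf5 using that by auto
  show **: "(1::gf5) \<noteq> 2" "(1::gf5) \<noteq> 3" "(1::gf5) \<noteq> 4" "(2::gf5) \<noteq> 3" "(2::gf5) \<noteq> 4" "(3::gf5) \<noteq> 4"
    by (rule *, simp)+
  show "(0::gf5) \<noteq> 2" "(0::gf5) \<noteq> 3" "(0::gf5) \<noteq> 4"
    using gf5_numeral_neq_0 by metis+
  show "(2::gf5) \<noteq> 1" "(3::gf5) \<noteq> 1" "(4::gf5) \<noteq> 1" "(3::gf5) \<noteq> 2" "(4::gf5) \<noteq> 2" "(4::gf5) \<noteq> 3"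
    using ** by metis+
qed

text \<open>The exponent 3 is prime to 4, the order of the multiplicative group.\<close>

lemma gf5_cube_inject: "x ^ 3 = y ^ 3 \<longleftrightarrow> x = y" for x y :: gf5
  by (cases x rule: gf5_cases; cases y rule: gf5_cases) (simp_all add: power3_eq_cube)

text \<open>Since 9 = 1 modulo 4, cubing is its own inverse, so \<open>x ^ 3\<close> is the cube
  root of \<open>x\<close>.\<close>

lemma gf5_power9: "x ^ 9 = x" for x :: gf5
  by (cases x rule: gf5_cases) (simp_all add: eval_nat_numeral)


section \<open>The stabilizer of a highest root vector\<close>

abbreviation e32 :: "gf5 ^ g2_basis" where "e32 \<equiv> axis (Root (Pos R32)) 1"
abbreviation f32 :: "gf5 ^ g2_basis" where "f32 \<equiv> axis (Root (Neg R32)) 1"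

lemma matrix_vector_mult_smult: "A *v (c *s x) = c *s (A *v x)" for A :: "'k::field ^ 'n ^ 'm"
  by (simp add: vector_scalar_commute)

lemma lie_smult: "lie (c *s x) y = c *s lie x y"
  by (simp add: vec_eq_iff lie_def sum_distrib_left mult_ac)

text \<open>The point is that \<open>(g - 1)\<^sup>2\<close> is a multiple of \<open>(ad e)\<^sup>2\<close>, whose image is spanned by \<open>e\<close>.\<close>

lemma centralizer_fixes_e32:
  assumes C: "lie_automorphism C" and "\<tau> \<noteq> 0"
    and comm: "C ** root_element (Pos R32) \<tau> = root_element (Pos R32) \<tau> ** C"
  shows "C *v e32 = e32"
proof -
  let ?G = "root_element (Pos R32) \<tau>"
  have CG: "C *v (?G *v x) = ?G *v (C *v x)" for x
    using comm by (simp add: matrix_vector_mul_assoc)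
  have sq: "?G *v (?G *v x) - 2 *s (?G *v x) + x = (- 2 * \<tau>\<^sup>2 * x $ Root (Neg R32)) *s e32" for x
    unfolding vec_eq_iff all_g2_basis
    by (intro conjI) (simp_all add: algebra_simps power2_eq_square axis_def)
  \<comment> \<open>Write D for \<open>lie e32\<close>, so \<open>?G\<close> is 1 + \<tau> D +
    \<tau>^2 D^2 / 2 with D^3 = 0. The combination (\<open>?G\<close> - 1)^2 - 2 (\<open>?G\<close>
    - 1) cancels D^2 and leaves -2 \<tau> D, so \<open>C\<close> commutes with D as well.\<close>
  have D: "?G *v (?G *v x) - 4 *s (?G *v x) + 3 *s x = (- 2 * \<tau>) *s lie e32 x" for x
    unfolding vec_eq_iff all_g2_basis
    by (intro conjI) (simp_all add: algebra_simps power2_eq_square axis_def)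
  note lin = matrix_vector_right_distrib matrix_vector_mult_diff_distrib matrix_vector_mult_smult
  have inj: "x = 0" if "C *v x = 0" for x
    using C that by (metis invertible_def lie_automorphism_def matrix_vector_mul_assoc
        matrix_vector_mul_lid matrix_vector_mult_0_right)
  \<comment> \<open>By \<open>sq\<close>, (\<open>?G\<close> - 1)^2 sees only the
    \<open>f32\<close>-coordinate and sends \<open>f32\<close> to a nonzero multiple of
    \<open>e32\<close>. Comparing its values before and after \<open>C\<close> makes
    \<open>e32\<close> an eigenvector with eigenvalue \<mu>.\<close>
  define \<mu> where "\<mu> = (C *v f32) $ Root (Neg R32)"
  have "C *v (?G *v (?G *v f32) - 2 *s (?G *v f32) + f32) = (- 2 * \<tau>\<^sup>2 * \<mu>) *s e32"
    using sq[of "C *v f32"] unfolding lin CG \<mu>_def by simp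
  then have "(- 2 * \<tau>\<^sup>2) *s (C *v e32) = (- 2 * \<tau>\<^sup>2) *s (\<mu> *s e32)"
    unfolding sq lin by (simp add: axis_def vector_smult_assoc)
  then have eig: "C *v e32 = \<mu> *s e32"
    using \<open>\<tau> \<noteq> 0\<close> by (simp add: vec_eq_iff)
  have "C *v ((- 2 * \<tau>) *s lie e32 x) = (- 2 * \<tau>) *s lie e32 (C *v x)" for x
    unfolding D[symmetric] lin CG by simp
  then have "(- 2 * \<tau>) *s (C *v lie e32 x) = (- 2 * \<tau>) *s lie e32 (C *v x)" for x
    unfolding lin by simp
  then have CD: "C *v lie e32 x = lie e32 (C *v x)" for x
    using \<open>\<tau> \<noteq> 0\<close> by (simp add: vec_eq_iff)
  \<comment> \<open>The highest root pairs to 1 with the coroot of \<beta>. Computing the image of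
    this bracket once through \<open>CD\<close> and once as the bracket of the images gives \<mu> =
    \<mu>^2.\<close>
  have "lie e32 (axis Cartan_b 1) = (-1) *s e32"
    unfolding vec_eq_iff all_g2_basis by (simp add: axis_def)
  then have *: "lie e32 (C *v axis Cartan_b 1) = (-1) *s (\<mu> *s e32)"
    using CD[of "axis Cartan_b 1"] eig by (simp add: matrix_vector_mult_smult)
  have "C *v lie e32 (axis Cartan_b 1) = \<mu> *s lie e32 (C *v axis Cartan_b 1)"
    using C eig by (simp add: lie_automorphism_def lie_smult)
  then have "\<mu> *s e32 = \<mu> *s (\<mu> *s e32)"
    unfolding CD * by (simp add: vec_eq_iff mult_ac)
  then have "\<mu> = \<mu> * \<mu>" 
    by (auto simp: vec_eq_iff axis_def dest: spec[of _ "Root (Pos R32)"])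
  moreover have "\<mu> \<noteq> 0" using inj[of e32] eig by (auto simp: axis_eq_0_iff)
  ultimately show ?thesis using eig by simp
qed

text \<open>Described through \<open>lie e32\<close> instead of coordinates, so that every
  automorphism fixing \<open>e32\<close> visibly preserves it.\<close>

definition heisenberg :: "(gf5 ^ g2_basis) set" where
  "heisenberg = {x. lie e32 x = 0 \<and> (\<exists>y. x = lie e32 y)}"

lemma in_heisenberg_iff:
  "x \<in> heisenberg \<longleftrightarrow>
     x $ Cartan_a = 0 \<and> x $ Cartan_b = 0 \<and> x $ Root (Pos R10) = 0 \<and> x $ Root (Neg R10) = 0 \<and>
     x $ Root (Neg R01) = 0 \<and> x $ Root (Neg R11) = 0 \<and> x $ Root (Neg R21) = 0 \<and>
     x $ Root (Neg R31) = 0 \<and> x $ Root (Neg R32) = 0"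
   (is "_ \<longleftrightarrow> ?P")
proof
  assume "x \<in> heisenberg"
  then show ?P unfolding heisenberg_def vec_eq_iff all_g2_basis by (auto simp: axis_def)
next
  assume ?P
  \<comment> \<open>\<open>lie e32\<close> sends each of these five basis vectors to plus or minus
    one of the root vectors spanning \<open>heisenberg\<close>; the signs in \<open>?y\<close> undo
    these signs.\<close>
  let ?y = "(\<chi> z. if z = Cartan_b then - x $ Root (Pos R32)
      else if z = Root (Neg R01) then - x $ Root (Pos R31)
      else if z = Root (Neg R11) then x $ Root (Pos R21)
      else if z = Root (Neg R21) then - x $ Root (Pos R11)
      else if z = Root (Neg R31) then x $ Root (Pos R01) else 0)"
  have "x = lie e32 ?y" "lie e32 x = 0"
    unfolding vec_eq_iff all_g2_basis using \<open>?P\<close> by (simp_all add: axis_def)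
  then show "x \<in> heisenberg" unfolding heisenberg_def by blast
qed

text \<open>No binomial coefficients appear because the structure constants absorb them:
  \<open>root_element (Pos R10) t\<close> acts by the substitution of (x + t y, y) for (x,
  y).\<close>

definition cube :: "gf5 \<Rightarrow> gf5 \<Rightarrow> gf5 ^ g2_basis" where
  "cube x y = (\<chi> z. if z = Root (Pos R31) then x ^ 3 else if z = Root (Pos R21) then x\<^sup>2 * y
     else if z = Root (Pos R11) then x * y\<^sup>2 else if z = Root (Pos R01) then y ^ 3 else 0)"

text \<open>The degree 0 part of \<open>[x, [x, f32]]\<close> is the Hessian of the cubic form given by \<open>x\<close>, which vanishes exactly
  on the multiples of cubes of linear forms; the scalars can be absorbed because cubing is
  bijective modulo 5.\<close>

lemma cone_iff:
  "x \<in> heisenberg \<and> (\<forall>y. lie x (lie x y) \<in> heisenberg) \<longleftrightarrow> (\<exists>p q c. x = cube p q + c *s e32)"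
  (is "?L \<longleftrightarrow> ?R")
proof
  assume ?R
  then obtain p q c where x: "x = cube p q + c *s e32" by blast
  show ?L unfolding x in_heisenberg_iff
    by (simp add: cube_def axis_def algebra_simps power2_eq_square power3_eq_cube)
next
  assume ?L
  then have Q: "x \<in> heisenberg" and "lie x (lie x f32) \<in> heisenberg" by blast+
  note z = Q[unfolded in_heisenberg_iff]
  let ?a = "x $ Root (Pos R31)" and ?b = "x $ Root (Pos R21)"
    and ?c = "x $ Root (Pos R11)" and ?d = "x $ Root (Pos R01)"
  \<comment> \<open>These are the vanishing 2 by 2 minors of the matrix with rows (a, b, c) and (b,
    c, d).\<close>
  have eqs: "?a * ?c = ?b * ?b" "?a * ?d = ?b * ?c" "?b * ?d = ?c * ?c"
    using \<open>lie x (lie x f32) \<in> heisenberg\<close> z unfolding in_heisenberg_iff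
    by (simp_all add: axis_def algebra_simps)
  have "\<exists>p q. ?a = p ^ 3 \<and> ?b = p\<^sup>2 * q \<and> ?c = p * q\<^sup>2 \<and> ?d = q ^ 3"
  proof (cases "?d = 0")
    case True
    \<comment> \<open>The third minor gives c = 0, then the first gives b = 0; \<open>?a ^ 3\<close>
      is the cube root of a.\<close>
    with eqs have "?a = (?a ^ 3) ^ 3 \<and> ?b = (?a ^ 3)\<^sup>2 * 0 \<and> ?c = ?a ^ 3 * 0\<^sup>2 \<and> ?d = 0 ^ 3"
      by (simp add: gf5_power9)
    then show ?thesis by blast
  next
    case False
    \<comment> \<open>The cube root of d. Then p is forced by p q^2 = c, and the formulas for a and
      b follow from the minors.\<close>
    define q where "q = ?d ^ 3"
    have d: "?d = q ^ 3" and "q \<noteq> 0" using False by (simp_all add: q_def gf5_power9)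
    have b: "?b = ?c * ?c / q ^ 3" and a: "?a = ?b * ?c / q ^ 3"
      using eqs d \<open>q \<noteq> 0\<close> by (simp_all add: field_simps)
    show ?thesis
      by (rule exI[of _ "?c / q\<^sup>2"], rule exI[of _ q])
        (use \<open>q \<noteq> 0\<close> in \<open>simp add: d a b field_simps power2_eq_square power3_eq_cube\<close>)
  qed
  then obtain p q where "?a = p ^ 3 \<and> ?b = p\<^sup>2 * q \<and> ?c = p * q\<^sup>2 \<and> ?d = q ^ 3"
    by blast
  then have "x = cube p q + (x $ Root (Pos R32)) *s e32"
    unfolding vec_eq_iff all_g2_basis using z by (simp add: cube_def axis_def)
  then show ?R by blast
qed

lemma cube_nth [simp]:
  "cube x y $ Cartan_a = 0" "cube x y $ Cartan_b = 0"
  "cube x y $ Root (Pos R10) = 0" "cube x y $ Root (Pos R01) = y ^ 3"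
  "cube x y $ Root (Pos R11) = x * y\<^sup>2" "cube x y $ Root (Pos R21) = x\<^sup>2 * y"
  "cube x y $ Root (Pos R31) = x ^ 3" "cube x y $ Root (Pos R32) = 0"
  "cube x y $ Root (Neg p) = 0"
  by (simp_all add: cube_def)

lemma e32_nth [simp]: "e32 $ z = (if z = Root (Pos R32) then 1 else 0)"
  by (simp add: axis_def)

lemma f32_nth [simp]: "f32 $ z = (if z = Root (Neg R32) then 1 else 0)"
  by (simp add: axis_def)

lemma cube_plus_e32_eqD:
  assumes "cube x y + c *s e32 = cube x' y' + c' *s e32"
  shows "x = x'" "y = y'" "c = c'"
proof -
  have *: "(cube x y + c *s e32) $ z = (cube x' y' + c' *s e32) $ z" for z using assms by simp
  show "x = x'" "y = y'" "c = c'"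
    using *[of "Root (Pos R31)"] *[of "Root (Pos R01)"] *[of "Root (Pos R32)"]
    by (simp_all add: gf5_cube_inject)
qed

text \<open>The structure constants 1, -3, 3, -1 that occur here are signed binomial coefficients,
  so the bracket is a perfect cube.\<close>

lemma lie_cube:
  "lie (cube x y + c *s e32) (cube x' y' + c' *s e32) = (y * x' - x * y') ^ 3 *s e32"
  unfolding vec_eq_iff all_g2_basis
  by (simp add: algebra_simps power2_eq_square power3_eq_cube)

section \<open>The linear action of the stabilizer on cubes of linear forms\<close>

locale stabilizer_e32 =
  fixes C :: "gf5 ^ g2_basis ^ g2_basis"
  assumes aut: "lie_automorphism C" and fixes_e32 [simp]: "C *v e32 = e32"
begin

lemma lin: "C *v (x + y) = C *v x + C *v y" "C *v (c *s x) = c *s (C *v x)"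
  by (simp_all add: matrix_vector_right_distrib matrix_vector_mult_smult)

lemma lie: "C *v lie x y = lie (C *v x) (C *v y)"
  using aut by (simp add: lie_automorphism_def)

lemma surj: "\<exists>y. x = C *v y"
  using aut by (metis invertible_def lie_automorphism_def matrix_vector_mul_assoc
        matrix_vector_mul_lid)

lemma heisenberg_closed: "x \<in> heisenberg \<Longrightarrow> C *v x \<in> heisenberg"
  unfolding heisenberg_def using lie[of e32] by (auto simp: ) (metis matrix_vector_mult_0_right)

text \<open>The characterization in \<open>cone_iff\<close> mentions only brackets and
  \<open>heisenberg\<close>, both preserved by \<open>C\<close>, and a quantifier over all vectors,
  each of which is an image under \<open>C\<close>.\<close>

lemma cube_image: "\<exists>p q c. C *v cube x y = cube p q + c *s e32"
proof -
  have "cube x y = cube x y + 0 *s e32" by simp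
  then have cone: "cube x y \<in> heisenberg" "lie (cube x y) (lie (cube x y) v) \<in> heisenberg" for v
    using cone_iff[of "cube x y"] by blast+
  have "lie (C *v cube x y) (lie (C *v cube x y) v) \<in> heisenberg" for v
    using surj[of v] heisenberg_closed[OF cone(2)] by (auto simp: lie)
  then show ?thesis using cone_iff[of "C *v cube x y"] heisenberg_closed[OF cone(1)] by blast
qed

text \<open>The induced map on pairs (x, y) preserves all determinants. Since a vector of the plane
  is determined by its determinants with two independent vectors, the map is linear.\<close>

lemma cube_linear:
  "\<exists>p q z d. p * d - q * z = 1 \<and>
     (\<forall>x y. \<exists>c. C *v cube x y = cube (p * x + q * y) (z * x + d * y) + c *s e32)"
proof -
  obtain p z c1 where 10: "C *v cube 1 0 = cube p z + c1 *s e32" using cube_image by blast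
  obtain q d c2 where 01: "C *v cube 0 1 = cube q d + c2 *s e32" using cube_image by blast
  \<comment> \<open>Cubing is injective modulo 5, so the determinant itself is preserved, and not only its cube.\<close>
  have det: "y * x' - x * y' = b * a' - a * b'"
    if "C *v cube x y = cube a b + c *s e32" "C *v cube x' y' = cube a' b' + c' *s e32"
    for x y x' y' a b a' b' c c'
  proof -
    have "C *v lie (cube x y) (cube x' y') = (b * a' - a * b') ^ 3 *s e32"
      unfolding lie that lie_cube ..
    moreover have "lie (cube x y) (cube x' y') = (y * x' - x * y') ^ 3 *s e32"
      using lie_cube[of x y 0 x' y' 0] by simp
    ultimately have "(y * x' - x * y') ^ 3 *s e32 = (b * a' - a * b') ^ 3 *s e32"
      by (simp add: lin)
    then have "((y * x' - x * y') ^ 3 *s e32) $ Root (Pos R32) = ((b * a' - a * b') ^ 3 *s e32) $ Root (Pos R32)"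
      by simp
    then show ?thesis by (simp add: gf5_cube_inject)
  qed
  have 1: "p * d - q * z = 1"
    using det[OF 01 10] by (simp add: mult_ac)
  have "\<exists>c. C *v cube x y = cube (p * x + q * y) (z * x + d * y) + c *s e32" for x y
  proof -
    obtain a b c where ab: "C *v cube x y = cube a b + c *s e32" using cube_image by blast
    \<comment> \<open>Determinants of the image (a, b) with the images (p, z) and (q, d) of the unit
      vectors; this system is inverted using p d - q z = 1.\<close>
    have y: "y = b * p - a * z" and x: "x = a * d - b * q"
      using det[OF ab 10] det[OF ab 01] by (simp_all add: minus_equation_iff[of x])
    have "p * x + q * y = a * (p * d - q * z)"
      unfolding x y by (simp add: algebra_simps)
    moreover have "z * x + d * y = b * (p * d - q * z)"
      unfolding x y by (simp add: algebra_simps)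
    ultimately show ?thesis using ab 1 by auto
  qed
  with 1 show ?thesis by blast
qed

end

text \<open>In characteristic 5, m^5 = 1 means (m - 1)^5 = 0, so m is unipotent. Here this is
  checked on all 625 matrices.\<close>

lemma gf5_unipotent_trace:
  fixes p q z d :: gf5
  defines "f \<equiv> \<lambda>x y. p * x + q * y" and "g \<equiv> \<lambda>x y. z * x + d * y"
  defines "F \<equiv> \<lambda>(x, y). (f x y, g x y)"
  assumes "p * d - q * z = 1" and "(F ^^ 5) (1, 0) = (1, 0)" and "(F ^^ 5) (0, 1) = (0, 1)"
  shows "p + d = 2"
  using assms(4-6) unfolding F_def f_def g_def
  by (cases p rule: gf5_cases; cases q rule: gf5_cases; cases z rule: gf5_cases;
      cases d rule: gf5_cases) (simp_all add: eval_nat_numeral)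

lemma lie_diff_right: "lie x (y - z) = lie x y - lie x z"
  by (simp add: vec_eq_iff lie_def algebra_simps sum_subtractf)

text \<open>The left-hand side is the fifth iterated difference of the sequence \<open>x, b, c, d, e, f\<close>.\<close>

lemma fifth_difference:
  fixes x :: "'a::comm_ring_1"
  shows "((((f - e) - (e - d)) - ((e - d) - (d - c))) - (((e - d) - (d - c)) - ((d - c) - (c - b))))
     - ((((e - d) - (d - c)) - ((d - c) - (c - b))) - (((d - c) - (c - b)) - ((c - b) - (b - x))))
    = f - x + 5 * (b - 2 * c + 2 * d - e)"
  by (simp add: algebra_simps)

definition heis_vec :: "gf5 \<Rightarrow> gf5 \<Rightarrow> gf5 \<Rightarrow> gf5 \<Rightarrow> gf5 \<Rightarrow> gf5 ^ g2_basis" where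
  "heis_vec a b c d u = a *s axis (Root (Pos R01)) 1 + b *s axis (Root (Pos R11)) 1
     + c *s axis (Root (Pos R21)) 1 + d *s axis (Root (Pos R31)) 1 + u *s e32"

lemma heis_vec_nth [simp]:
  "heis_vec a b c d u $ Cartan_a = 0" "heis_vec a b c d u $ Cartan_b = 0"
  "heis_vec a b c d u $ Root (Pos R10) = 0" "heis_vec a b c d u $ Root (Pos R01) = a"
  "heis_vec a b c d u $ Root (Pos R11) = b" "heis_vec a b c d u $ Root (Pos R21) = c"
  "heis_vec a b c d u $ Root (Pos R31) = d" "heis_vec a b c d u $ Root (Pos R32) = u"
  "heis_vec a b c d u $ Root (Neg p) = 0"
  by (simp_all add: heis_vec_def axis_def)

section \<open>Fifth roots of a root element for the highest root\<close>

locale stabilizer_e32_fifth = stabilizer_e32 +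
  fixes \<tau>
  assumes fifth: "C *v (C *v (C *v (C *v (C *v x)))) = root_element (Pos R32) \<tau> *v x"
begin

text \<open>The fifth power of \<open>C\<close> acts trivially on the Heisenberg algebra and a cube
  determines its linear form, so the fifth power of the induced matrix is the identity.\<close>

lemma trace:
  assumes det: "p * d - q * z = 1"
    and rel: "\<And>x y. \<exists>c. C *v cube x y = cube (p * x + q * y) (z * x + d * y) + c *s e32"
  shows "p + d = 2"
proof -
  define F where "F = (\<lambda>(x, y). (p * x + q * y, z * x + d * y))"
  \<comment> \<open>The multiple of \<open>e32\<close> is left open, as the matrix depends only on
    the action modulo \<open>e32\<close>.\<close>
  define R where "R v w \<longleftrightarrow> (\<exists>c. v = cube (fst w) (snd w) + c *s e32)" for v and w :: "gf5 \<times> gf5"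
  have step: "R (C *v v) (F w)" if "R v w" for v w
  proof -
    obtain c where v: "v = cube (fst w) (snd w) + c *s e32" using \<open>R v w\<close> unfolding R_def by blast
    obtain c' where "C *v cube (fst w) (snd w) = cube (fst (F w)) (snd (F w)) + c' *s e32"
      using rel[of "fst w" "snd w"] by (auto simp: F_def case_prod_beta)
    then have "C *v v = cube (fst (F w)) (snd (F w)) + (c' + c) *s e32"
      unfolding v lin by (simp add: vector_sadd_rdistrib)
    then show ?thesis unfolding R_def by blast
  qed
  have "(F ^^ 5) w = w" for w
  proof -
    let ?v = "cube (fst w) (snd w)"
    have "R ?v w" unfolding R_def by (rule exI[of _ 0]) simp
    then have "R (C *v (C *v (C *v (C *v (C *v ?v))))) ((F ^^ 5) w)"
      by (simp add: eval_nat_numeral step)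
    moreover have "root_element (Pos R32) \<tau> *v ?v = ?v + 0 *s e32"
      unfolding vec_eq_iff all_g2_basis by simp
    ultimately obtain c where "?v + 0 *s e32 = cube (fst ((F ^^ 5) w)) (snd ((F ^^ 5) w)) + c *s e32"
      unfolding fifth R_def by auto
    from cube_plus_e32_eqD(1,2)[OF this] show ?thesis by (simp add: prod_eq_iff)
  qed
  then show ?thesis
    using gf5_unipotent_trace[OF det] unfolding F_def by blast
qed

text \<open>In characteristic 5 one has \<open>C\<^sup>5 - 1 = (C - 1)\<^sup>5\<close>; this is applied to the coroot \<open>h = [e, f]\<close>, which
  \<open>C - 1\<close> maps into the Heisenberg algebra, where \<open>C\<close> is known up to multiples of \<open>e\<close>.\<close>

lemma parameters:
  assumes upper: "\<And>x y. \<exists>c. C *v cube x y = cube (x + s * y) y + c *s e32"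
    and e31: "C *v cube 1 0 = cube 1 0 + t *s e32"
  shows "2 * \<tau> = s ^ 3 * t\<^sup>2"
proof -
  \<comment> \<open>The cubes at (0, 1), (1, 1), (-1, 1) and (1, 0) form a basis of the binary cubic
    forms; note 4 = -1.\<close>
  obtain c0 where c0: "C *v cube 0 1 = cube s 1 + c0 *s e32" using upper[of 0 1] by auto
  obtain c1 where c1: "C *v cube 1 1 = cube (1 + s) 1 + c1 *s e32" using upper[of 1 1] by auto
  obtain c2 where c2: "C *v cube 4 1 = cube (4 + s) 1 + c2 *s e32" using upper[of 4 1] by auto
  \<comment> \<open>Half the sum and half the difference of \<open>cube 1 1\<close> and
    \<open>cube 4 1\<close> separate even from odd powers of x, with 3 = 1/2 and 2 = -1/2. This
    isolates the root vectors for \<open>R21\<close> and \<open>R11\<close>; \<open>c21\<close> and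
    \<open>c11\<close> are the \<open>e32\<close>-coefficients of their images.\<close>
  define c11 c21 where "c11 = 3 * c1 - 3 * c2 - t" and "c21 = 3 * c1 + 3 * c2 - c0"
  have decomp: "heis_vec a b c d u = a *s cube 0 1 + b *s (3 *s cube 1 1 + 2 *s cube 4 1 + 4 *s cube 1 0)
      + c *s (3 *s cube 1 1 + 3 *s cube 4 1 + 4 *s cube 0 1) + d *s cube 1 0 + u *s e32" for a b c d u
    unfolding vec_eq_iff all_g2_basis by (simp add: power2_eq_square power3_eq_cube)
  define N where "N v = C *v v - v" for v
  have N: "N (heis_vec a b c d u) = heis_vec 0 (s * a) (2 * s * b + s\<^sup>2 * a)
      (3 * s * c + 3 * s\<^sup>2 * b + s ^ 3 * a) (t * d + c21 * c + c11 * b + c0 * a)" for a b c d u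
    unfolding N_def decomp lin c0 c1 c2 e31 fixes_e32 unfolding vec_eq_iff all_g2_basis
    by (simp add: algebra_simps power2_eq_square power3_eq_cube c11_def c21_def)
  define h where "h = lie e32 f32"
  define q where "q = N h"
  \<comment> \<open>As \<open>C\<close> fixes \<open>e32\<close>, q is a bracket with
    \<open>e32\<close>. As the bracket of \<open>e32\<close> with h is a multiple of
    \<open>e32\<close>, q also commutes with \<open>e32\<close>.\<close>
  have "q = lie e32 (C *v f32 - f32)"
    by (simp add: q_def N_def h_def lie lie_diff_right)
  moreover have "lie e32 q = 0"
  proof -
    have "lie e32 h = 3 *s e32"
      unfolding vec_eq_iff all_g2_basis h_def by simp
    then have "lie e32 (C *v h) = lie e32 h"
      using lie[of e32 h] by (simp add: lin)
    then show ?thesis by (simp add: q_def N_def lie_diff_right)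
  qed
  ultimately have "q \<in> heisenberg" by (auto simp: heisenberg_def)
  then have q: "q = heis_vec (q $ Root (Pos R01)) (q $ Root (Pos R11)) (q $ Root (Pos R21))
      (q $ Root (Pos R31)) (q $ Root (Pos R32))"
    unfolding in_heisenberg_iff vec_eq_iff[of q] all_g2_basis by simp
  \<comment> \<open>The root of \<open>R31\<close> pairs to 1 with the coroot h. Applying
    \<open>C\<close> to this relation and reading off the \<open>e32\<close>-coefficient gives 2 t +
    q01 = t, with q01 the \<open>R01\<close>-coordinate of q.\<close>
  have "lie h (cube 1 0) = cube 1 0"
    unfolding vec_eq_iff all_g2_basis h_def by simp
  then have "lie (h + q) (cube 1 0 + t *s e32) = cube 1 0 + t *s e32"
    using lie[of h "cube 1 0"] by (simp add: q_def N_def e31)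
  then have "lie (h + q) (cube 1 0 + t *s e32) $ Root (Pos R32) = t"
    by simp
  then have q01: "q $ Root (Pos R01) = - t"
    using \<open>q \<in> heisenberg\<close> unfolding in_heisenberg_iff h_def by (simp add: algebra_simps add_eq_0_iff)
  \<comment> \<open>Three applications of \<open>N\<close> carry the \<open>R01\<close>-coordinate
    -t to \<open>R31\<close> with factor 6 s^3 = s^3, the fourth carries it to \<open>e32\<close>
    with factor t; contributions of the other coordinates have vanished by then.\<close>
  have "N (N (N (N q))) = heis_vec 0 0 0 0 (- (s ^ 3 * t\<^sup>2))"
    by (subst q) (simp add: N q01 power2_eq_square power3_eq_cube algebra_simps)
  moreover have "N (N (N (N (N v)))) = C *v (C *v (C *v (C *v (C *v v)))) - v" for v
    unfolding N_def matrix_vector_mult_diff_distrib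
    unfolding vec_eq_iff vector_minus_component fifth_difference by simp
  ultimately have "root_element (Pos R32) \<tau> *v h - h = heis_vec 0 0 0 0 (- (s ^ 3 * t\<^sup>2))"
    by (simp add: q_def fifth)
  \<comment> \<open>The \<open>Cartan_b\<close>-coordinate of h is 2, so the left-hand side is -2
    \<tau>.\<close>
  then have "(root_element (Pos R32) \<tau> *v h - h) $ Root (Pos R32) = - (s ^ 3 * t\<^sup>2)"
    by simp
  then show ?thesis by (simp add: h_def mult_ac)
qed

end

text \<open>The four root elements in \<open>CB\<close> multiply to the inverse of
  \<open>wit_a\<close> times \<open>wit_b\<close>, the u^-1 of the outline; the parameter 2 belongs
  to the 15th power of \<open>wit_a\<close>.\<close>

lemma no_common_fifth_root:
  fixes C B :: "gf5 ^ g2_basis ^ g2_basis"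
  assumes C: "lie_automorphism C" and B: "lie_automorphism B"
    and C5: "\<And>v. C *v (C *v (C *v (C *v (C *v v)))) = root_element (Pos R32) 2 *v v"
    and B5: "\<And>v. B *v (B *v (B *v (B *v (B *v v)))) = root_element (Pos R32) 2 *v v"
    and CB: "\<And>v. B *v v = C *v (root_element (Pos R01) (- 2) *v (root_element (Pos R10) (- 3) *v
      (root_element (Pos R10) 2 *v (root_element (Pos R01) 1 *v v))))"
  shows False
proof -
  have fixes_e32: "A *v e32 = e32" if A: "lie_automorphism (A :: gf5 ^ g2_basis ^ g2_basis)"
    and A5: "\<And>v. A *v (A *v (A *v (A *v (A *v v)))) = root_element (Pos R32) 2 *v v" for A
  proof (rule centralizer_fixes_e32[OF A, of 2])
    show "A ** root_element (Pos R32) 2 = root_element (Pos R32) 2 ** A"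
      unfolding matrix_eq by (simp flip: A5 matrix_vector_mul_assoc)
  qed simp
  interpret C: stabilizer_e32_fifth C 2
    by unfold_locales (simp_all add: C C5 fixes_e32)
  interpret B: stabilizer_e32_fifth B 2
    by unfold_locales (simp_all add: B B5 fixes_e32)
  obtain p q z d where det: "p * d - q * z = 1"
    and Crel: "\<And>x y. \<exists>c. C *v cube x y = cube (p * x + q * y) (z * x + d * y) + c *s e32"
    using C.cube_linear by blast
  \<comment> \<open>The two middle factors combine to \<open>root_element (Pos R10) (- 1)\<close>, a
    transvection; the outer factors only add the multiples x^3 and -2 (x - y)^3 of
    \<open>e32\<close>.\<close>
  have quotient: "root_element (Pos R01) (- 2) *v (root_element (Pos R10) (- 3) *v
      (root_element (Pos R10) 2 *v (root_element (Pos R01) 1 *v cube x y)))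
      = cube (x - y) y + (x ^ 3 - 2 * (x - y) ^ 3) *s e32" for x y
    unfolding vec_eq_iff all_g2_basis
    by (simp add: algebra_simps power2_eq_square power3_eq_cube)
  have CB_cube: "B *v cube x y = C *v cube (x - y) y + (x ^ 3 - 2 * (x - y) ^ 3) *s e32" for x y
    unfolding CB quotient by (simp add: C.lin matrix_vector_mult_diff_distrib)
  have Brel: "\<exists>c. B *v cube x y = cube (p * x + (q - p) * y) (z * x + (d - z) * y) + c *s e32" for x y
  proof -
    obtain c where "C *v cube (x - y) y = cube (p * (x - y) + q * y) (z * (x - y) + d * y) + c *s e32"
      using Crel by blast
    then have "B *v cube x y = cube (p * x + (q - p) * y) (z * x + (d - z) * y)
        + (c + (x ^ 3 - 2 * (x - y) ^ 3)) *s e32"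
      unfolding CB_cube by (simp add: algebra_simps vector_sadd_rdistrib)
    then show ?thesis by blast
  qed
  \<comment> \<open>Passing from \<open>C\<close> to \<open>B\<close> subtracts the first column of
    the matrix from the second, so the trace drops by z.\<close>
  have "p + d = 2" by (rule C.trace[OF det Crel])
  moreover have "p + (d - z) = 2"
    by (rule B.trace[OF _ Brel]) (use det in \<open>simp add: algebra_simps\<close>)
  ultimately have "z = 0" by (simp add: algebra_simps)
  \<comment> \<open>From p d = 1 and p + d = 2 one gets (p - 1)^2 = 0.\<close>
  moreover have "p = 1 \<and> d = 1"
    using det \<open>z = 0\<close> \<open>p + d = 2\<close>
    by (cases p rule: gf5_cases; cases d rule: gf5_cases) simp_all
  ultimately have m: "p = 1" "z = 0" "d = 1" by auto
  obtain t where t: "C *v cube 1 0 = cube 1 0 + t *s e32"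
    using Crel[of 1 0] m by auto
  have "2 * 2 = q ^ 3 * t\<^sup>2"
    using C.parameters[of q t] Crel t m by simp
  moreover have "2 * 2 = (q - 1) ^ 3 * (t - 1)\<^sup>2"
  proof (rule B.parameters)
    show "\<exists>c. B *v cube x y = cube (x + (q - 1) * y) y + c *s e32" for x y
      using Brel[of x y] m by simp
    show "B *v cube 1 0 = cube 1 0 + (t - 1) *s e32"
      unfolding CB_cube using t by (simp add: vec_eq_iff algebra_simps)
  qed
  \<comment> \<open>The solutions (q, t) of q^3 t^2 = 4 are (4, 1), (4, 4), (1, 2), (1, 3); lowering
    both entries by one never gives another solution.\<close>
  ultimately show False
    by (cases q rule: gf5_cases; cases t rule: gf5_cases) (simp_all add: eval_nat_numeral)
qed


section \<open>Fifth powers of two regular unipotent elements\<close>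

text \<open>A vector as a single term, so that applying a root element rewrites it to a term of the
  same shape.\<close>

definition coords ::
  "'k \<Rightarrow> 'k \<Rightarrow> 'k \<Rightarrow> 'k \<Rightarrow> 'k \<Rightarrow> 'k \<Rightarrow> 'k \<Rightarrow> 'k \<Rightarrow>
     'k \<Rightarrow> 'k \<Rightarrow> 'k \<Rightarrow> 'k \<Rightarrow> 'k \<Rightarrow> 'k \<Rightarrow> 'k ^ g2_basis" where
  "coords a b c1 c2 c3 c4 c5 c6 d1 d2 d3 d4 d5 d6 =
     (\<chi> z. case z of Cartan_a \<Rightarrow> a | Cartan_b \<Rightarrow> b
       | Root (Pos p) \<Rightarrow> (case p of R10 \<Rightarrow> c1 | R01 \<Rightarrow> c2 | R11 \<Rightarrow> c3 | R21 \<Rightarrow> c4 | R31 \<Rightarrow> c5 | R32 \<Rightarrow> c6)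
       | Root (Neg p) \<Rightarrow> (case p of R10 \<Rightarrow> d1 | R01 \<Rightarrow> d2 | R11 \<Rightarrow> d3 | R21 \<Rightarrow> d4 | R31 \<Rightarrow> d5 | R32 \<Rightarrow> d6))"

lemma root_element_coords:
  fixes t :: "'k::field"
  shows
  "root_element (Pos R10) t *v coords a b c1 c2 c3 c4 c5 c6 d1 d2 d3 d4 d5 d6
     = coords (a + t * d1) b (c1 - 2 * (t * a) + t * b - t^2 * d1) c2 (c3 + t * c2)
       (c4 + 2 * (t * c3) + t^2 * c2) (c5 + 3 * (t * c4) + 3 * (t^2 * c3) + t^3 * c2) c6 d1
       (d2 - 3 * (t * d3) + 3 * (t^2 * d4) - t^3 * d5) (d3 - 2 * (t * d4) + t^2 * d5)
       (d4 - t * d5) d5 d6"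
  "root_element (Pos R01) t *v coords a b c1 c2 c3 c4 c5 c6 d1 d2 d3 d4 d5 d6
     = coords a (b + t * d2) c1 (c2 - 2 * (t * b) + 3 * (t * a) - t^2 * d2) (c3 - t * c1) c4 c5
       (c6 + t * c5) (d1 + t * d3) d2 d3 d4 (d5 - t * d6) d6"
  "root_element (Pos R32) t *v coords a b c1 c2 c3 c4 c5 c6 d1 d2 d3 d4 d5 d6
     = coords (a + t * d6) (b + 2 * (t * d6)) c1 (c2 + t * d5) (c3 - t * d4) (c4 + t * d3)
       (c5 - t * d2) (c6 - t * b - t^2 * d6) d1 d2 d3 d4 d5 d6"
  unfolding vec_eq_iff all_g2_basis by (simp_all add: coords_def)

lemma axis_coords:
  "axis Cartan_a 1 = coords 1 0 0 0 0 0 0 0 0 0 0 0 0 0"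
  "axis Cartan_b 1 = coords 0 1 0 0 0 0 0 0 0 0 0 0 0 0"
  "axis (Root (Pos R10)) 1 = coords 0 0 1 0 0 0 0 0 0 0 0 0 0 0"
  "axis (Root (Pos R01)) 1 = coords 0 0 0 1 0 0 0 0 0 0 0 0 0 0"
  "axis (Root (Pos R11)) 1 = coords 0 0 0 0 1 0 0 0 0 0 0 0 0 0"
  "axis (Root (Pos R21)) 1 = coords 0 0 0 0 0 1 0 0 0 0 0 0 0 0"
  "axis (Root (Pos R31)) 1 = coords 0 0 0 0 0 0 1 0 0 0 0 0 0 0"
  "axis (Root (Pos R32)) 1 = coords 0 0 0 0 0 0 0 1 0 0 0 0 0 0"
  "axis (Root (Neg R10)) 1 = coords 0 0 0 0 0 0 0 0 1 0 0 0 0 0"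
  "axis (Root (Neg R01)) 1 = coords 0 0 0 0 0 0 0 0 0 1 0 0 0 0"
  "axis (Root (Neg R11)) 1 = coords 0 0 0 0 0 0 0 0 0 0 1 0 0 0"
  "axis (Root (Neg R21)) 1 = coords 0 0 0 0 0 0 0 0 0 0 0 1 0 0"
  "axis (Root (Neg R31)) 1 = coords 0 0 0 0 0 0 0 0 0 0 0 0 1 0"
  "axis (Root (Neg R32)) 1 = coords 0 0 0 0 0 0 0 0 0 0 0 0 0 1"
  unfolding vec_eq_iff all_g2_basis by (simp_all add: coords_def axis_def)

lemma matrix_eq_axisI:
  fixes A :: "'k::semiring_1 ^ 'n ^ 'm"
  assumes "\<And>z. A *v axis z 1 = B *v axis z 1"
  shows "A = B"
proof -
  have "A $ i $ z = B $ i $ z" for i z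
    using arg_cong[OF assms[of z], of "\<lambda>v. v $ i"]
    by (simp add: matrix_vector_mult_def axis_def if_distrib cong: if_cong)
  then show ?thesis by (simp add: vec_eq_iff)
qed

text \<open>Both pairs satisfy s^3 t^2 = 2 * 4, the condition of \<open>parameters\<close> for
  \<tau> = 4, and they differ by (1, 1), the shift between \<open>C\<close> and \<open>B\<close> in
  \<open>no_common_fifth_root\<close>.\<close>

lemma fifth_power_eq:
  assumes "(s, t) = (3, 2) \<or> (s, t) = (2, 1 :: gf5)"
  defines "A \<equiv> root_element (Pos R10) s ** root_element (Pos R01) t"
  shows "A ** A ** A ** A ** A = root_element (Pos R32) 4"
proof (rule matrix_eq_axisI)
  fix z
  have "\<forall>z. A ** A ** A ** A ** A *v axis z 1 = root_element (Pos R32) 4 *v axis z 1"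
    unfolding all_g2_basis axis_coords A_def
    using assms(1) by (elim disjE; intro conjI)
      (simp_all add: root_element_coords power2_eq_square power3_eq_cube flip: matrix_vector_mul_assoc)
  then show "A ** A ** A ** A ** A *v axis z 1 = root_element (Pos R32) 4 *v axis z 1" ..
qed

section \<open>Prime power subgroups and a criterion in finite groups\<close>

text \<open>\<open>H\<close> acts on the left cosets of \<open>P\<close>. Their number is prime to p
  while all orbits have p-power length, so some coset xP is fixed, and then x^-1 H x lies in
  \<open>P\<close>.\<close>

lemma (in group) prime_power_subgroup_conjugate_into_sylow:
  assumes fin: "finite (carrier G)" and p: "prime p"
    and H: "subgroup H G" "card H = p ^ k"
    and P: "subgroup P G" "card P = p ^ multiplicity p (order G)"
  obtains x where "x \<in> carrier G" "\<And>h. h \<in> H \<Longrightarrow> inv x \<otimes> h \<otimes> x \<in> P"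
proof -
  interpret P: subgroup P G by fact
  interpret H: subgroup H G by fact
  let ?E = "lcosets P" and ?K = "G\<lparr>carrier := H\<rparr>"
  \<comment> \<open>The restriction to the cosets makes the maps extensional, as \<open>Bij\<close>
    requires.\<close>
  define \<phi> where "\<phi> = (\<lambda>g. \<lambda>M\<in>?E. g <# M)"
  have sub: "M \<subseteq> carrier G" if "M \<in> ?E" for M
    using P.lcosets_carrier[OF is_group that] .
  have closed: "g <# M \<in> ?E" if "g \<in> carrier G" "M \<in> ?E" for g M
    using that P.subset by (auto simp: LCOSETS_def lcos_m_assoc)
  have comp: "g <# (h <# M) = (g \<otimes> h) <# M" if "g \<in> carrier G" "h \<in> carrier G" "M \<in> ?E" for g h M
    using lcos_m_assoc[OF sub[OF that(3)]] that by simp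
  have Bij: "\<phi> g \<in> Bij ?E" if g: "g \<in> carrier G" for g
  proof -
    have "bij_betw (\<phi> g) ?E ?E"
      using g closed comp[of g "inv g"] comp[of "inv g" g] lcos_mult_one[OF sub]
      by (intro bij_betw_byWitness[where f' = "\<phi> (inv g)"]) (auto simp: \<phi>_def)
    then show ?thesis by (simp add: Bij_def \<phi>_def)
  qed
  have "\<phi> \<in> hom ?K (BijGroup ?E)"
  proof (rule homI)
    fix g h assume "g \<in> carrier ?K" "h \<in> carrier ?K"
    then have gh: "g \<in> carrier G" "h \<in> carrier G" by (simp_all add: H.mem_carrier)
    then show "\<phi> (g \<otimes>\<^bsub>?K\<^esub> h) = \<phi> g \<otimes>\<^bsub>BijGroup ?E\<^esub> \<phi> h"
      using Bij[of g] Bij[of h] closed comp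
      by (auto simp: BijGroup_def compose_def \<phi>_def fun_eq_iff)
  qed (use Bij in \<open>simp add: BijGroup_def\<close>)
  then interpret A: group_action ?K ?E \<phi>
    unfolding group_action_def group_hom_def group_hom_axioms_def
    using subgroup_imp_group[OF H(1)] group_BijGroup by blast
  have "order G > 0"
    using fin order_gt_0_iff_finite by blast
  have "\<not> p dvd card ?E"
  proof
    assume "p dvd card ?E"
    then have "p * card P dvd card ?E * card P"
      by (rule mult_dvd_mono) simp
    then have "p ^ Suc (multiplicity p (order G)) dvd order G"
      unfolding l_lagrange[OF fin P(1)] unfolding P(2) by (simp only: power_Suc)
    then show False
      using \<open>order G > 0\<close> p not_prime_unit[of p]
      by (subst (asm) power_dvd_iff_le_multiplicity) auto
  qed
  have finE: "finite ?E"
    using fin by (auto simp: LCOSETS_def)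
  have sum: "card ?E = (\<Sum>orb\<in>orbits ?K ?E \<phi>. card orb)"
    using A.disjoint_sum[OF finE, of "\<lambda>_. 1 :: nat"] by simp
  obtain orb where orb: "orb \<in> orbits ?K ?E \<phi>" "\<not> p dvd card orb"
    using \<open>\<not> p dvd card ?E\<close> unfolding sum by (blast intro: dvd_sum)
  then obtain M where M: "M \<in> ?E" "orb = orbit ?K \<phi> M"
    by (auto simp: orbits_def)
  have "card orb * card (stabilizer ?K \<phi> M) = p ^ k"
    using A.orbit_stabilizer_theorem[OF M(1)] M(2) H(2) by (simp add: order_def)
  then have "card orb dvd p ^ k"
    by (metis dvd_triv_left)
  then obtain j where j: "card orb = p ^ j"
    using divides_primepow_nat[OF p] by blast
  then have "card orb = 1"
    using orb(2) by (cases j) simp_all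
  moreover have "M \<in> orb"
    using A.orbit_refl[OF M(1)] M(2) by simp
  ultimately have "orb = {M}"
    by (auto simp: card_1_singleton_iff)
  then have fixed: "h <# M = M" if "h \<in> H" for h
    using that M by (auto simp: orbit_def \<phi>_def)
  obtain x where x: "x \<in> carrier G" "M = x <# P"
    using M(1) by (auto simp: LCOSETS_def)
  have "inv x \<otimes> h \<otimes> x \<in> P" if h: "h \<in> H" for h
  proof -
    have "h \<otimes> x \<in> h <# M"
      using lcos_self[OF x(1) P(1)] unfolding x(2) l_coset_def[of _ h] by blast
    then have "h \<otimes> x \<in> x <# P"
      using fixed[OF h] x(2) by simp
    then have "inv x \<otimes> (h \<otimes> x) \<in> P"
      by (rule P.lcos_module_imp[OF is_group x(1)])
    then show ?thesis
      using h x(1) by (simp add: m_assoc H.mem_carrier)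
  qed
  with x(1) show thesis by (rule that)
qed

text \<open>Take g = a^15, u = b^-1 a and the exponent 2. The set for g is empty by
  \<open>none\<close>, whereas g^2 = a^30 = a^5 and a u^-1 = b put a into the set for g^2.\<close>

lemma (in group) not_FSZ_5I:
  assumes fin: "finite (carrier G)" and a: "a \<in> carrier G" and b: "b \<in> carrier G"
    and pow: "a [^] (5::nat) = b [^] (5::nat)" and ord: "a [^] (25::nat) = \<one>"
    and none: "\<And>c. c \<in> carrier G \<Longrightarrow> c [^] (5::nat) = a [^] (15::nat) \<Longrightarrow>
      (c \<otimes> (inv a \<otimes> b)) [^] (5::nat) = a [^] (15::nat) \<Longrightarrow> False"
  shows "\<not> FSZ 5 G"
proof
  assume FSZ: "FSZ 5 G"
  define g u where "g = a [^] (15::nat)" and "u = inv b \<otimes> a"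
  have carr: "g \<in> carrier G" "u \<in> carrier G"
    using a b by (simp_all add: g_def u_def)
  have u: "inv u = inv a \<otimes> b"
    using a b by (simp add: u_def inv_mult_group)
  have b15: "g = b [^] (15::nat)"
    using pow a b nat_pow_pow[of a 5 3] nat_pow_pow[of b 5 3] by (simp add: g_def)
  have ga: "g \<otimes> a = a \<otimes> g"
    using nat_pow_comm[OF a, of 15 1] a by (simp add: g_def)
  have gb: "g \<otimes> b = b \<otimes> g"
    using nat_pow_comm[OF b, of 15 1] b by (simp add: b15)
  have "u \<otimes> g = g \<otimes> u"
  proof -
    have "inv b \<otimes> g = inv b \<otimes> (g \<otimes> b) \<otimes> inv b"
      using carr b by (simp add: m_assoc)
    also have "\<dots> = g \<otimes> inv b"
      unfolding gb using carr b by (simp flip: m_assoc)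
    finally have *: "inv b \<otimes> g = g \<otimes> inv b" .
    have "u \<otimes> g = inv b \<otimes> (g \<otimes> a)"
      using carr a b ga by (simp add: u_def m_assoc)
    also have "\<dots> = g \<otimes> u"
      using carr a b * by (simp add: u_def flip: m_assoc)
    finally show ?thesis .
  qed
  then have "u \<in> centralizer G g"
    using carr by (simp add: centralizer_def)
  moreover have "g [^] (5::nat) = \<one>"
    using a ord nat_pow_pow[of a 25 3] by (simp add: g_def nat_pow_pow)
  then have "group.ord G g dvd 5"
    using pow_eq_id carr by blast
  then have "coprime 2 (group.ord G g)"
    using coprime_divisors[of 2 2 _ "5 :: nat"] by simp
  ultimately have "card (FSZ_set G 5 u g) = card (FSZ_set G 5 u (g [^] (2::nat)))"
    using FSZ carr unfolding FSZ_def by (metis zero_less_numeral)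
  moreover have "FSZ_set G 5 u g = {}"
    using none by (auto simp: FSZ_set_def u g_def)
  moreover have "g [^] (2::nat) = a [^] (5::nat)"
    using a ord nat_pow_mult[of a 25 5] by (simp add: g_def nat_pow_pow)
  then have "a \<in> FSZ_set G 5 u (g [^] (2::nat))"
    using a b pow by (simp add: FSZ_set_def u flip: m_assoc)
  moreover have "finite (FSZ_set G 5 u (g [^] (2::nat)))"
    using fin by (simp add: FSZ_set_def)
  ultimately show False
    by (metis card_0_eq card.empty empty_iff)
qed

text \<open>Conjugation by x is an automorphism that moves a and b into \<open>P\<close>; a
  forbidden element of \<open>P\<close> would be conjugated back to one of the whole group.\<close>

lemma (in group) not_FSZ_5_conjugate:
  assumes fin: "finite (carrier G)" and a: "a \<in> carrier G" and b: "b \<in> carrier G"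
    and pow: "a [^] (5::nat) = b [^] (5::nat)" and ord: "a [^] (25::nat) = \<one>"
    and none: "\<And>c. c \<in> carrier G \<Longrightarrow> c [^] (5::nat) = a [^] (15::nat) \<Longrightarrow>
      (c \<otimes> (inv a \<otimes> b)) [^] (5::nat) = a [^] (15::nat) \<Longrightarrow> False"
    and P: "subgroup P G" and x: "x \<in> carrier G"
    and aP: "inv x \<otimes> a \<otimes> x \<in> P" and bP: "inv x \<otimes> b \<otimes> x \<in> P"
  shows "\<not> FSZ 5 (G\<lparr>carrier := P\<rparr>)"
proof -
  define \<kappa> where "\<kappa> y = inv x \<otimes> y \<otimes> x" for y
  have cancel: "x \<otimes> (inv x \<otimes> y) = y" if "y \<in> carrier G" for y
    using x that by (simp flip: m_assoc)
  interpret \<kappa>: group_hom G G \<kappa>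
    using x by unfold_locales (auto simp: \<kappa>_def hom_def m_assoc cancel)
  have inj: "y = z" if "\<kappa> y = \<kappa> z" "y \<in> carrier G" "z \<in> carrier G" for y z
    using that x by (simp add: \<kappa>_def)
  interpret P: group "G\<lparr>carrier := P\<rparr>"
    by (rule subgroup_imp_group[OF P])
  have powP: "y [^]\<^bsub>G\<lparr>carrier := P\<rparr>\<^esub> n = y [^] n" for y and n :: nat
    by (rule nat_pow_consistent[symmetric])
  have invP: "inv\<^bsub>G\<lparr>carrier := P\<rparr>\<^esub> y = inv y" if "y \<in> P" for y
    using m_inv_consistent[OF P that] .
  have \<kappa>P: "\<kappa> a \<in> P" "\<kappa> b \<in> P" using aP bP by (simp_all add: \<kappa>_def)
  show ?thesis
  proof (rule P.not_FSZ_5I[of "\<kappa> a" "\<kappa> b"])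
    show "finite (carrier (G\<lparr>carrier := P\<rparr>))"
      using fin subgroup.subset[OF P] finite_subset by auto
    show "\<kappa> a [^]\<^bsub>G\<lparr>carrier := P\<rparr>\<^esub> (5::nat) = \<kappa> b [^]\<^bsub>G\<lparr>carrier := P\<rparr>\<^esub> (5::nat)"
      unfolding powP using a b pow by (simp flip: \<kappa>.hom_nat_pow)
    show "\<kappa> a [^]\<^bsub>G\<lparr>carrier := P\<rparr>\<^esub> (25::nat) = \<one>\<^bsub>G\<lparr>carrier := P\<rparr>\<^esub>"
      unfolding powP using a ord by (simp flip: \<kappa>.hom_nat_pow)
  next
    fix c
    assume "c \<in> carrier (G\<lparr>carrier := P\<rparr>)"
      and c5: "c [^]\<^bsub>G\<lparr>carrier := P\<rparr>\<^esub> (5::nat) = \<kappa> a [^]\<^bsub>G\<lparr>carrier := P\<rparr>\<^esub> (15::nat)"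
      and cab5: "(c \<otimes>\<^bsub>G\<lparr>carrier := P\<rparr>\<^esub> (inv\<^bsub>G\<lparr>carrier := P\<rparr>\<^esub> \<kappa> a \<otimes>\<^bsub>G\<lparr>carrier := P\<rparr>\<^esub> \<kappa> b))
        [^]\<^bsub>G\<lparr>carrier := P\<rparr>\<^esub> (5::nat) = \<kappa> a [^]\<^bsub>G\<lparr>carrier := P\<rparr>\<^esub> (15::nat)"
    then have c: "c \<in> carrier G" using subgroup.mem_carrier[OF P] by simp
    define d where "d = x \<otimes> c \<otimes> inv x"
    have d: "d \<in> carrier G" "\<kappa> d = c"
      using c x by (simp_all add: d_def \<kappa>_def m_assoc) (simp flip: m_assoc)
    have "\<kappa> (d [^] (5::nat)) = \<kappa> (a [^] (15::nat))"
      using c5 d a by (simp add: powP \<kappa>.hom_nat_pow)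
    moreover have "\<kappa> ((d \<otimes> (inv a \<otimes> b)) [^] (5::nat)) = \<kappa> (a [^] (15::nat))"
      using cab5 d a b by (simp add: powP invP[OF \<kappa>P(1)] \<kappa>.hom_nat_pow)
    ultimately show False
      using none[OF d(1)] inj a b d by simp
  qed (use \<kappa>P in simp_all)
qed

section \<open>The Chevalley group over the field with five elements\<close>

definition unitriangular :: "('n \<Rightarrow> int) \<Rightarrow> 'k::field ^ 'n ^ 'n \<Rightarrow> bool" where
  "unitriangular h A \<longleftrightarrow>
     (\<forall>i. A $ i $ i = 1) \<and> (\<forall>i j. i \<noteq> j \<longrightarrow> A $ i $ j \<noteq> 0 \<longrightarrow> h j < h i)"

lemma unitriangularD:
  assumes "unitriangular h A"
  shows "A $ i $ i = 1" and "i \<noteq> j \<Longrightarrow> A $ i $ j \<noteq> 0 \<Longrightarrow> h j < h i"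
  using assms unfolding unitriangular_def by auto

text \<open>Unless \<open>h j < h i\<close>, a term of the product entry can be nonzero only for k =
  i = j, because a nonzero off-diagonal entry forces a strict increase of height.\<close>

lemma unitriangular_mult:
  fixes A B :: "'k::field ^ 'n::finite ^ 'n"
  assumes A: "unitriangular h A" and B: "unitriangular h B"
  shows "unitriangular h (A ** B)"
proof -
  have entry: "(A ** B) $ i $ j = (if i = j then 1 else 0)" if "\<not> h j < h i" for i j
  proof -
    have "A $ i $ k * B $ k $ j = (if k = i then if i = j then 1 else 0 else 0)" for k
    proof (cases "k = i")
      case True
      then show ?thesis
        using unitriangularD(1)[OF A, of i] unitriangularD[OF B] that by auto
    next
      case False
      have "A $ i $ k = 0 \<or> B $ k $ j = 0"
        using unitriangularD(2)[OF A, of i k] unitriangularD(2)[OF B, of k j] that False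
        by (cases "k = j") force+
      with False show ?thesis by auto
    qed
    then show ?thesis by (simp add: matrix_matrix_mult_def)
  qed
  show ?thesis
    unfolding unitriangular_def
  proof (intro conjI allI impI)
    show "(A ** B) $ i $ i = 1" for i using entry[of i i] by simp
    show "h j < h i" if "i \<noteq> j" "(A ** B) $ i $ j \<noteq> 0" for i j
      using entry[of j i] that by (cases "h j < h i") simp_all
  qed
qed

text \<open>The kernel is trivial: at an index of minimal height in the support of x, the product
  has the same coordinate as x.\<close>

lemma invertible_unitriangular:
  fixes A :: "'k::field ^ 'n::finite ^ 'n"
  assumes A: "unitriangular h A"
  shows "invertible A"
proof -
  have "x = 0" if x: "A *v x = 0" for x
  proof (rule ccontr)
    assume "x \<noteq> 0"
    then have "{i. x $ i \<noteq> 0} \<noteq> {}" by (auto simp: vec_eq_iff)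
    then obtain i where i: "x $ i \<noteq> 0" and min: "\<And>j. x $ j \<noteq> 0 \<Longrightarrow> h i \<le> h j"
      using ex_min_if_finite[of "h ` {i. x $ i \<noteq> 0}"] by (fastforce simp: not_less)
    have "A $ i $ j * x $ j = (if j = i then x $ i else 0)" for j
      using unitriangularD(1)[OF A, of i] unitriangularD(2)[OF A, of i j] min[of j] by (cases "A $ i $ j = 0") force+
    then have "(A *v x) $ i = x $ i" by (simp add: matrix_vector_mult_def)
    with x i show False by simp
  qed
  then have "\<exists>B. B ** A = mat 1" using matrix_left_invertible_ker by blast
  then show ?thesis by (simp add: invertible_left_inverse)
qed

text \<open>Translation by x is injective on the finite set \<open>H\<close>, hence onto, and so
  reaches the unit.\<close>

lemma (in group) finite_closed_imp_subgroup:
  assumes "finite H" "H \<subseteq> carrier G" "\<one> \<in> H" and closed: "\<And>x y. x \<in> H \<Longrightarrow> y \<in> H \<Longrightarrow> x \<otimes> y \<in> H"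
  shows "subgroup H G"
proof (rule subgroupI)
  fix x assume x: "x \<in> H"
  have "inj_on ((\<otimes>) x) H"
    using inj_on_cmult[of x] x assms(2) inj_on_subset by blast
  then have "(\<otimes>) x ` H = H"
    using assms(1) closed x by (intro endo_inj_surj) auto
  then obtain y where y: "y \<in> H" "x \<otimes> y = \<one>" using assms(3) by (metis imageE)
  then have "inv x = y" using x assms(2) by (intro inv_equality) (auto intro: inv_comm)
  then show "inv x \<in> H" using y by simp
qed (use assms in auto)

lemma subgroup_unitriangular:
  "subgroup {A. unitriangular h A} (GL :: ('k::{field,finite} ^ 'n::finite ^ 'n) monoid)"
proof (rule group.finite_closed_imp_subgroup[OF group_GL])
  show "\<one>\<^bsub>GL\<^esub> \<in> {A :: 'k ^ 'n ^ 'n. unitriangular h A}"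
    by (simp add: unitriangular_def mat_def)
qed (auto simp: invertible_unitriangular unitriangular_mult)

text \<open>The entries with \<open>h j < h i\<close> can be chosen freely, all others are
  prescribed.\<close>

lemma card_unitriangular:
  "\<exists>k. card {A :: gf5 ^ 'n::finite ^ 'n. unitriangular h A} = 5 ^ k"
proof -
  let ?S = "{(i, j). h j < h i}" and ?T = "{A :: gf5 ^ 'n ^ 'n. unitriangular h A}"
  let ?f = "\<lambda>A. \<lambda>(i, j)\<in>?S. A $ i $ j"
  have "bij_betw ?f ?T (?S \<rightarrow>\<^sub>E UNIV)"
  proof (rule bij_betw_byWitness[where f' =
        "\<lambda>f. \<chi> i j. if i = j then 1 else if h j < h i then f (i, j) else 0"])
    show "\<forall>A\<in>?T. (\<chi> i j. if i = j then 1 else if h j < h i then ?f A (i, j) else 0) = A"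
      by (auto simp: vec_eq_iff unitriangular_def)
    show "\<forall>f\<in>?S \<rightarrow>\<^sub>E UNIV. ?f (\<chi> i j. if i = j then 1 else if h j < h i then f (i, j) else 0) = f"
      by (auto simp: fun_eq_iff PiE_def extensional_def)
    show "?f ` ?T \<subseteq> ?S \<rightarrow>\<^sub>E UNIV"
      by (intro image_subsetI) (simp add: restrict_PiE_iff)
  qed (auto simp: unitriangular_def)
  then have "card ?T = card (?S \<rightarrow>\<^sub>E (UNIV :: gf5 set))" by (rule bij_betw_same_card)
  also have "\<dots> = 5 ^ card ?S" by (simp add: card_PiE CARD_five)
  finally show ?thesis ..
qed

fun height :: "g2_basis \<Rightarrow> int" where
  "height (Root r) = fst (root_vec r) + snd (root_vec r)"
| "height _ = 0"

text \<open>Bracketing with a simple root vector raises the height by one, so its exponential is the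
  identity plus height-raising terms.\<close>

lemma unitriangular_root_element:
  "unitriangular height (root_element (Pos R10) t)" "unitriangular height (root_element (Pos R01) t)"
proof -
  have *: "A $ i $ j = (A *v axis j 1) $ i" for A :: "'a ^ g2_basis ^ g2_basis" and i j
    by (simp add: matrix_vector_mult_def axis_def if_distrib cong: if_cong)
  show "unitriangular height (root_element (Pos R10) t)" "unitriangular height (root_element (Pos R01) t)"
    unfolding unitriangular_def all_g2_basis * by (simp_all add: axis_def)
qed

section \<open>The two witnesses and their powers\<close>

definition wit_a :: "gf5 ^ g2_basis ^ g2_basis" where
  "wit_a = root_element (Pos R10) 3 ** root_element (Pos R01) 2"

definition wit_b :: "gf5 ^ g2_basis ^ g2_basis" where
  "wit_b = root_element (Pos R10) 2 ** root_element (Pos R01) 1"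

lemma root_element_R32_add:
  "root_element (Pos R32) s ** root_element (Pos R32) t = root_element (Pos R32) (s + t)"
  unfolding matrix_eq matrix_vector_mul_assoc[symmetric] vec_eq_iff[of "_ *v _"] all_g2_basis
  by (simp add: algebra_simps power2_eq_square)

interpretation G2: group G2_5 by (rule group_G2)

lemma wit_in_G2: "wit_a \<in> carrier G2_5" "wit_b \<in> carrier G2_5"
  using G2.m_closed[OF root_element_in_G2 root_element_in_G2] by (simp_all add: wit_a_def wit_b_def)

lemma G2_pow:
  "A [^]\<^bsub>G2_5\<^esub> (3::nat) = A ** A ** A" "A [^]\<^bsub>G2_5\<^esub> (5::nat) = A ** A ** A ** A ** A"
  by (simp_all add: eval_nat_numeral matrix_mul_assoc)

lemma wit_pow:
  "wit_a [^]\<^bsub>G2_5\<^esub> (5::nat) = root_element (Pos R32) 4"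
  "wit_b [^]\<^bsub>G2_5\<^esub> (5::nat) = root_element (Pos R32) 4"
  "wit_a [^]\<^bsub>G2_5\<^esub> (15::nat) = root_element (Pos R32) 2"
  "wit_a [^]\<^bsub>G2_5\<^esub> (25::nat) = mat 1"
proof -
  show a: "wit_a [^]\<^bsub>G2_5\<^esub> (5::nat) = root_element (Pos R32) 4"
    and "wit_b [^]\<^bsub>G2_5\<^esub> (5::nat) = root_element (Pos R32) 4"
    unfolding G2_pow wit_a_def wit_b_def by (rule fifth_power_eq; simp)+
  have 0: "root_element (Pos R32) (0::gf5) = mat 1"
    unfolding matrix_eq vec_eq_iff[of "_ *v _"] all_g2_basis by simp
  \<comment> \<open>Parameters of root elements for \<open>R32\<close> add up, and 3 * 4 = 2 and 5 *
    4 = 0 modulo 5.\<close>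
  have "wit_a [^]\<^bsub>G2_5\<^esub> (15::nat) = (wit_a [^]\<^bsub>G2_5\<^esub> (5::nat)) [^]\<^bsub>G2_5\<^esub> (3::nat)"
    and "wit_a [^]\<^bsub>G2_5\<^esub> (25::nat) = (wit_a [^]\<^bsub>G2_5\<^esub> (5::nat)) [^]\<^bsub>G2_5\<^esub> (5::nat)"
    by (simp_all add: G2.nat_pow_pow[OF wit_in_G2(1)])
  then show "wit_a [^]\<^bsub>G2_5\<^esub> (15::nat) = root_element (Pos R32) 2"
    "wit_a [^]\<^bsub>G2_5\<^esub> (25::nat) = mat 1"
    unfolding a unfolding G2_pow by (simp_all add: root_element_R32_add 0)
qed

lemma inv_wit_a: "inv\<^bsub>G2_5\<^esub> wit_a = root_element (Pos R01) (- 2) ** root_element (Pos R10) (- 3)"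
proof (rule G2.inv_equality)
  have cancel: "root_element r (- t) *v (root_element r t *v v) = v" for r and t :: gf5 and v
    using root_element_uminus[of r "- t"] by (simp add: matrix_vector_mul_assoc)
  show "root_element (Pos R01) (- 2) ** root_element (Pos R10) (- 3) \<otimes>\<^bsub>G2_5\<^esub> wit_a = \<one>\<^bsub>G2_5\<^esub>"
    unfolding matrix_eq G2_simps wit_a_def matrix_vector_mul_assoc[symmetric] cancel by simp
  show "root_element (Pos R01) (- 2) ** root_element (Pos R10) (- 3) \<in> carrier G2_5"
    using G2.m_closed[OF root_element_in_G2 root_element_in_G2] by (simp only: G2_simps)
qed (rule wit_in_G2)

lemma no_fifth_root_pair:
  assumes c: "c \<in> carrier G2_5"
    and c5: "c [^]\<^bsub>G2_5\<^esub> (5::nat) = wit_a [^]\<^bsub>G2_5\<^esub> (15::nat)"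
    and b5: "(c \<otimes>\<^bsub>G2_5\<^esub> (inv\<^bsub>G2_5\<^esub> wit_a \<otimes>\<^bsub>G2_5\<^esub> wit_b)) [^]\<^bsub>G2_5\<^esub> (5::nat)
      = wit_a [^]\<^bsub>G2_5\<^esub> (15::nat)"
  shows False
proof -
  define b where "b = c \<otimes>\<^bsub>G2_5\<^esub> (inv\<^bsub>G2_5\<^esub> wit_a \<otimes>\<^bsub>G2_5\<^esub> wit_b)"
  have b: "b \<in> carrier G2_5"
    unfolding b_def by (intro G2.m_closed G2.inv_closed c wit_in_G2)
  have pow: "A *v (A *v (A *v (A *v (A *v v)))) = root_element (Pos R32) 2 *v v"
    if "A [^]\<^bsub>G2_5\<^esub> (5::nat) = wit_a [^]\<^bsub>G2_5\<^esub> (15::nat)" for A v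
    unfolding that[unfolded wit_pow G2_pow, symmetric] matrix_vector_mul_assoc
    by (simp add: matrix_mul_assoc)
  have "b *v v = c *v (root_element (Pos R01) (- 2) *v (root_element (Pos R10) (- 3) *v
      (root_element (Pos R10) 2 *v (root_element (Pos R01) 1 *v v))))" for v
    unfolding b_def inv_wit_a wit_b_def G2_simps matrix_vector_mul_assoc[symmetric] ..
  then show False
    by (rule no_common_fifth_root[OF G2_lie_automorphism[OF c] G2_lie_automorphism[OF b]
          pow[OF c5] pow[OF b5[folded b_def]]])
qed

theorem theorem4p1:
  shows "\<not> FSZ 5 G2_5 \<and>
         (\<forall>P. sylow_subgroup 5 G2_5 P \<longrightarrow> \<not> FSZ 5 (G2_5\<lparr>carrier := P\<rparr>))"
proof (intro conjI allI impI)
  have fin: "finite (carrier G2_5)" by (rule finite)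
  have pow: "wit_a [^]\<^bsub>G2_5\<^esub> (5::nat) = wit_b [^]\<^bsub>G2_5\<^esub> (5::nat)" "wit_a [^]\<^bsub>G2_5\<^esub> (25::nat) = \<one>\<^bsub>G2_5\<^esub>"
    by (simp_all only: wit_pow G2_simps)
  show "\<not> FSZ 5 G2_5"
    by (rule G2.not_FSZ_5I[OF fin wit_in_G2 pow no_fifth_root_pair])
  fix P assume "sylow_subgroup 5 G2_5 P"
  then have P: "subgroup P G2_5" "card P = 5 ^ multiplicity 5 (order G2_5)"
    by (simp_all add: sylow_subgroup_def)
  let ?T = "{A :: gf5 ^ g2_basis ^ g2_basis. unitriangular height A}"
  \<comment> \<open>A 5-group containing both witnesses: by Lagrange its order divides that of the
    full unitriangular group. It can therefore be conjugated into the given Sylow subgroup.\<close>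
  define H where "H = ?T \<inter> carrier G2_5"
  have "subgroup H GL"
    unfolding H_def by (intro group.subgroups_Inter_pair[OF group_GL] subgroup_unitriangular subgroup_G2)
  then have H: "subgroup H G2_5" and HT: "subgroup H (GL\<lparr>carrier := ?T\<rparr>)"
    using group.subgroup_incl[OF group_GL _ subgroup_G2] group.subgroup_incl[OF group_GL _ subgroup_unitriangular]
    by (auto simp: H_def chevalley_G2_def)
  interpret T: group "GL\<lparr>carrier := ?T\<rparr> :: (gf5 ^ g2_basis ^ g2_basis) monoid"
    by (rule group.subgroup_imp_group[OF group_GL subgroup_unitriangular])
  obtain n where "card ?T = 5 ^ n" using card_unitriangular by blast
  then have "card (rcosets\<^bsub>GL\<lparr>carrier := ?T\<rparr>\<^esub> H) * card H = 5 ^ n"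
    using T.lagrange[OF HT] by (simp add: order_def)
  then have "card H dvd 5 ^ n" by (metis dvd_triv_right)
  then obtain k where k: "card H = 5 ^ k" using divides_primepow_nat[of 5 "card H" n] by auto
  have "prime (5::nat)" by simp
  then obtain x where x: "x \<in> carrier G2_5"
    "\<And>h. h \<in> H \<Longrightarrow> inv\<^bsub>G2_5\<^esub> x \<otimes>\<^bsub>G2_5\<^esub> h \<otimes>\<^bsub>G2_5\<^esub> x \<in> P"
    using G2.prime_power_subgroup_conjugate_into_sylow[OF fin _ H k P] by blast
  have wit_H: "wit_a \<in> H" "wit_b \<in> H"
    unfolding H_def using wit_in_G2
    by (simp_all add: wit_a_def wit_b_def unitriangular_mult unitriangular_root_element)
  show "\<not> FSZ 5 (G2_5\<lparr>carrier := P\<rparr>)"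
    by (rule G2.not_FSZ_5_conjugate[OF fin wit_in_G2 pow _ P(1) x(1) x(2)[OF wit_H(1)] x(2)[OF wit_H(2)]])
      (rule no_fifth_root_pair)
qed

end
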